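(* There exist absolute constants $C_1, C_2>0$ (independent of $d$ and $n$) such that for all integers $d\geq 2$ and $n\geq 1$, with $m:=n+d$, $$\frac{C_1 d}{1+\log \frac{m}{d}} \;\leq\; k(d,n) \;\leq\; 1+\frac{C_2 d}{1+\log \frac{m}{d}}.$$ In particular, for every integer $d\ge 2$ there exists a centrally symmetric $d$-dimensional polytope with exactly $4d$ vertices that is at least $\frac{d}{400}$-neighborly.
   Context: A polytope $P\subset\mathbb{R}^d$ (convex hull of finitely many points) is centrally symmetric (cs) if $x\in P$ implies $-x\in P$. A $d$-polytope is a polytope of dimension $d$. A cs polytope $P$ with $2m$ vertices is called $k$-neighborly, where $1\le k\le m$ is an integer, if every set of $k$ of its vertices, no two of which are antipodal (i.e. no two of the form $v,-v$), is the vertex set of a face of $P$. For a real number $r>0$, "at least $r$-neighborly" means $k$-neighborly for every integer $k$ with $1\le k\le r$. For integers $d\ge 2$, $n\ge 1$, $k(d,n)$ denotes the largest integer $k$ such that there exists a $k$-neighborly cs $d$-polytope with exactly $2(n+d)$ vertices. Here $\log$ is the natural logarithm. *)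

theory Defs
  imports "HOL-Analysis.Analysis" "HOL-Analysis.Finite_Function_Topology"
begin

(* The dimension d is quantified inside the theorem (the constants must not depend on it), so it
   cannot be a type.  Space \<real>\<^sup>d is therefore realised as the subspace of those finitely supported
   real sequences that vanish outside the coordinates 0, ..., d - 1. *)

type_synonym rvec = "nat \<Rightarrow>\<^sub>0 real"

definition euclid :: "nat \<Rightarrow> rvec set" where
  "euclid d = {x. Poly_Mapping.keys x \<subseteq> {..<d}}"

(* The defining condition of aff_dim, which the library restricts to class euclidean_space.
   As d + 1 > 0, the affine basis B is finite. *)
definition has_aff_dim :: "'a::real_vector set \<Rightarrow> nat \<Rightarrow> bool" where
  "has_aff_dim S d \<longleftrightarrow>
     (\<exists>B. affine hull B = affine hull S \<and> \<not> affine_dependent B \<and> card B = d + 1)"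

definition vertices :: "'a::real_vector set \<Rightarrow> 'a set" where
  "vertices P = {v. v extreme_point_of P}"

definition cs_polytope :: "nat \<Rightarrow> rvec set \<Rightarrow> bool" where
  "cs_polytope d P \<longleftrightarrow>
     P \<subseteq> euclid d \<and> polytope P \<and> has_aff_dim P d \<and> (\<forall>x\<in>P. - x \<in> P)"

(* With card (vertices P) = 2 * m, the second conjunct says k \<le> m. *)
definition neighborly :: "nat \<Rightarrow> 'a::real_vector set \<Rightarrow> bool" where
  "neighborly k P \<longleftrightarrow>
     1 \<le> k \<and> 2 * k \<le> card (vertices P) \<and>
     (\<forall>S. S \<subseteq> vertices P \<and> card S = k \<and> pairwise (\<lambda>u v. u \<noteq> - v) S
        \<longrightarrow> (\<exists>F. F face_of P \<and> vertices F = S))"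

definition at_least_neighborly :: "real \<Rightarrow> 'a::real_vector set \<Rightarrow> bool" where
  "at_least_neighborly r P \<longleftrightarrow> (\<forall>k::nat. 1 \<le> k \<and> real k \<le> r \<longrightarrow> neighborly k P)"

(* The maximum is attained for d \<ge> 2 and n \<ge> 1: every such k is at most n + d, and every centrally
   symmetric d-polytope with 2 * (n + d) vertices (these exist) is 1-neighborly. *)
definition max_neighborly :: "nat \<Rightarrow> nat \<Rightarrow> nat" where
  "max_neighborly d n =
     (GREATEST k. \<exists>P. cs_polytope d P \<and> card (vertices P) = 2 * (n + d) \<and> neighborly k P)"

end

theory Submission
  imports Defs
begin

text \<open>
  Lower bound: project the cross-polytope of \<open>m\<close> dimensions to \<open>d\<close> dimensions by a matrix whose kernel
  contains no nonzero vector with half of its \<open>l1\<close> norm on \<open>k\<close> coordinates; then every set of at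
  most \<open>k\<close> pairwise non-antipodal vertices spans a face. A random sign matrix \<open>A\<close> works. A bad kernel
  vector \<open>h\<close> with \<open>l1\<close> norm 1 has squared \<open>l2\<close> norm at least \<open>1 / (4 k)\<close>. As the columns of \<open>A\<close> have
  squared length \<open>d\<close>, averaging \<open>N = 8 k + 1\<close> signed unit vectors sampled according to \<open>h\<close> yields an
  integer vector \<open>z\<close> with \<open>l1\<close> norm \<open>N\<close> and \<open>|A z|\<^sup>2 \<le> d |z|\<^sup>2 / 3\<close>. For a fixed \<open>z\<close> a random \<open>A\<close>
  does this with probability at most \<open>0.876 ^ d\<close>, and there are few such \<open>z\<close>. For small \<open>d\<close>, points on a circle
  suffice.

  Upper bound: for \<open>s = k div 2\<close>, take a large family of \<open>s\<close>-subsets of a half of the vertices, any two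
  meeting in at most \<open>s / 2\<close> points. Neighborliness makes their barycentres 1-separated in the norm
  with unit ball \<open>P\<close>, so there are at most \<open>4 ^ d\<close> of them.
\<close>

text \<open>Kernel vectors form a continuum, out of reach of a union bound; sampling replaces them
  by finitely many integer points. What survives sampling is the quadratic form |Ax|^2 - (d/3)
  |x|^2. It is 2d/3 at a signed unit vector and -(d/3) |h|^2 at a kernel vector h, so the sum of N
  draws with mean h has expected value N (2d/3) - N (N - 1) (d/3) |h|^2. This is nonpositive once (N
  - 1) |h|^2 is at least 2, and |h|^2 >= 1/(4k) leads to N - 1 = 8k. The additional draw makes N
  odd, which keeps the sum away from 0. Replacing 1/3 by a smaller fraction would make bad matrices
  rarer, but would need more draws. The random construction has to deliver d/400 only from d = 800
  on, because below that no k greater than 1 is asked for. In the upper bound k is halved because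
  the difference of two barycentres of s vertices is a positive multiple of the barycentre of up to
  2s vertices, half of them negated, and these must lie in one proper face. Small intersections keep
  that multiple at least 1.\<close>

section \<open>The null space property and faces of projected cross-polytopes\<close>

text \<open>The null space property of compressed sensing, for the matrix with columns \<open>a 0, \<dots>, a (m - 1)\<close>.\<close>

definition nsp :: "nat \<Rightarrow> nat \<Rightarrow> (nat \<Rightarrow> 'a::real_vector) \<Rightarrow> bool" where
  "nsp k m a \<longleftrightarrow> (\<forall>h S. (\<Sum>j<m. h j *\<^sub>R a j) = 0 \<and> (\<exists>j<m. h j \<noteq> 0) \<and> S \<subseteq> {..<m} \<and> card S \<le> k
      \<longrightarrow> 2 * (\<Sum>j\<in>S. \<bar>h j\<bar>) < (\<Sum>j<m. \<bar>h j\<bar>))"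

lemma nspD:
  assumes "nsp k m a" "(\<Sum>j<m. h j *\<^sub>R a j) = 0" "j < m" "h j \<noteq> 0" "S \<subseteq> {..<m}" "card S \<le> k"
  shows "2 * (\<Sum>j\<in>S. \<bar>h j\<bar>) < (\<Sum>j<m. \<bar>h j\<bar>)"
  using assms unfolding nsp_def by blast

lemma convex_hull_image_coeffs:
  fixes f :: "'i \<Rightarrow> 'a::real_vector"
  assumes "finite J" "x \<in> convex hull (f ` J)"
  obtains \<mu> where "\<And>j. j \<in> J \<Longrightarrow> 0 \<le> \<mu> j" "sum \<mu> J = 1" "x = (\<Sum>j\<in>J. \<mu> j *\<^sub>R f j)"
proof -
  let ?Q = "{x. \<exists>\<mu>. (\<forall>j\<in>J. 0 \<le> \<mu> j) \<and> sum \<mu> J = 1 \<and> x = (\<Sum>j\<in>J. \<mu> j *\<^sub>R f j)}"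
  have "convex ?Q"
    unfolding convex_def
  proof (intro ballI allI impI)
    fix x y :: 'a and u v :: real
    assume x: "x \<in> ?Q" and y: "y \<in> ?Q" and uv: "0 \<le> u" "0 \<le> v" "u + v = 1"
    obtain c where c: "\<forall>j\<in>J. 0 \<le> c j" "sum c J = 1" "x = (\<Sum>j\<in>J. c j *\<^sub>R f j)" using x by auto
    obtain c' where c': "\<forall>j\<in>J. 0 \<le> c' j" "sum c' J = 1" "y = (\<Sum>j\<in>J. c' j *\<^sub>R f j)" using y by auto
    show "u *\<^sub>R x + v *\<^sub>R y \<in> ?Q"
      using uv c c' by (intro CollectI exI[of _ "\<lambda>j. u * c j + v * c' j"])
        (simp add: scaleR_sum_right scaleR_add_left sum.distrib flip: sum_distrib_left)
  qed
  moreover have "f ` J \<subseteq> ?Q"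
  proof safe
    fix i assume "i \<in> J"
    then show "\<exists>\<mu>. (\<forall>j\<in>J. 0 \<le> \<mu> j) \<and> sum \<mu> J = 1 \<and> f i = (\<Sum>j\<in>J. \<mu> j *\<^sub>R f j)"
      using assms(1) by (intro exI[of _ "\<lambda>j. if j = i then 1 else 0"])
        (simp add: if_distrib[of "\<lambda>t. t *\<^sub>R _"] sum.delta cong: if_cong)
  qed
  ultimately have "convex hull (f ` J) \<subseteq> ?Q" by (intro hull_minimal)
  with assms(2) that show thesis by blast
qed

text \<open>Image of the standard cross-polytope under the linear map that sends the
  \<open>j\<close>-th unit vector to \<open>a j\<close>.\<close>

definition cross_hull :: "nat \<Rightarrow> (nat \<Rightarrow> 'a::real_vector) \<Rightarrow> 'a set" where
  "cross_hull m a = convex hull (a ` {..<m} \<union> (\<lambda>j. - a j) ` {..<m})"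

lemma cross_hull_coeffs:
  fixes a :: "nat \<Rightarrow> 'a::real_vector"
  assumes "x \<in> cross_hull m a"
  obtains c where "x = (\<Sum>j<m. c j *\<^sub>R a j)" "(\<Sum>j<m. \<bar>c j\<bar>) \<le> 1"
proof -
  let ?Q = "{x. \<exists>c. x = (\<Sum>j<m. c j *\<^sub>R a j) \<and> (\<Sum>j<m. \<bar>c j\<bar>) \<le> 1}"
  have "convex ?Q"
    unfolding convex_def
  proof (intro ballI allI impI)
    fix x y :: 'a and u v :: real
    assume x: "x \<in> ?Q" and y: "y \<in> ?Q" and uv: "0 \<le> u" "0 \<le> v" "u + v = 1"
    obtain c where c: "x = (\<Sum>j<m. c j *\<^sub>R a j)" "(\<Sum>j<m. \<bar>c j\<bar>) \<le> 1" using x by auto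
    obtain c' where c': "y = (\<Sum>j<m. c' j *\<^sub>R a j)" "(\<Sum>j<m. \<bar>c' j\<bar>) \<le> 1" using y by auto
    have "(\<Sum>j<m. \<bar>u * c j + v * c' j\<bar>) \<le> (\<Sum>j<m. u * \<bar>c j\<bar> + v * \<bar>c' j\<bar>)"
      using uv by (intro sum_mono) (metis abs_mult abs_of_nonneg abs_triangle_ineq)
    also have "\<dots> = u * (\<Sum>j<m. \<bar>c j\<bar>) + v * (\<Sum>j<m. \<bar>c' j\<bar>)"
      by (simp add: sum.distrib sum_distrib_left)
    also have "\<dots> \<le> u * 1 + v * 1"
      using c c' uv by (intro add_mono mult_left_mono) auto
    finally have "(\<Sum>j<m. \<bar>u * c j + v * c' j\<bar>) \<le> 1" using uv by simp
    moreover have "u *\<^sub>R x + v *\<^sub>R y = (\<Sum>j<m. (u * c j + v * c' j) *\<^sub>R a j)"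
      unfolding c(1) c'(1) by (simp add: scaleR_sum_right scaleR_add_left sum.distrib)
    ultimately show "u *\<^sub>R x + v *\<^sub>R y \<in> ?Q"
      by (intro CollectI exI[of _ "\<lambda>j. u * c j + v * c' j"]) auto
  qed
  moreover have "a ` {..<m} \<union> (\<lambda>j. - a j) ` {..<m} \<subseteq> ?Q"
  proof -
    have *: "e *\<^sub>R a i \<in> ?Q" if "i < m" "\<bar>e\<bar> = 1" for i e
      using that by (intro CollectI exI[of _ "\<lambda>j. if j = i then e else 0"])
        (simp add: if_distrib[of abs] if_distrib[of "\<lambda>t. t *\<^sub>R _"] sum.delta cong: if_cong)
    show ?thesis using *[of _ 1] *[of _ "-1"] by auto
  qed
  ultimately have "cross_hull m a \<subseteq> ?Q"
    unfolding cross_hull_def by (intro hull_minimal)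
  with assms that show thesis by blast
qed

lemma cross_hull_minus:
  assumes "x \<in> cross_hull m a" shows "- x \<in> cross_hull m a"
proof -
  have "uminus ` cross_hull m a = convex hull (uminus ` (a ` {..<m} \<union> (\<lambda>j. - a j) ` {..<m}))"
    unfolding cross_hull_def
    by (rule convex_hull_linear_image, intro linearI) auto
  also have "uminus ` (a ` {..<m} \<union> (\<lambda>j. - a j) ` {..<m}) = a ` {..<m} \<union> (\<lambda>j. - a j) ` {..<m}"
    by (auto simp: image_Un image_image)
  finally show ?thesis using assms unfolding cross_hull_def by (metis image_eqI)
qed

text \<open>A point of the signed hull has only one representation with coefficients of
  \<open>l1\<close> norm at most 1: two would differ by a kernel vector with half of its mass on
  \<open>J\<close>. Hence the endpoints of a segment through such a point also have all their mass
  on \<open>J\<close>, with the signs \<open>\<epsilon>\<close>.\<close>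

lemma signed_hull_face:
  fixes a :: "nat \<Rightarrow> 'a::real_vector"
  assumes nsp: "nsp k m a" and J: "J \<subseteq> {..<m}" "card J \<le> k" and \<epsilon>: "\<And>j. j \<in> J \<Longrightarrow> \<bar>\<epsilon> j\<bar> = (1::real)"
  shows "convex hull ((\<lambda>j. \<epsilon> j *\<^sub>R a j) ` J) face_of cross_hull m a"
  unfolding face_of_def
proof (intro conjI ballI impI)
  have finJ: "finite J" using J(1) finite_subset by blast
  have \<epsilon>_cases: "\<epsilon> j = 1 \<or> \<epsilon> j = -1" if "j \<in> J" for j using \<epsilon>[OF that] by linarith
  show "convex hull ((\<lambda>j. \<epsilon> j *\<^sub>R a j) ` J) \<subseteq> cross_hull m a"
    unfolding cross_hull_def
  proof (rule hull_mono, safe)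
    fix j assume "j \<in> J" "\<epsilon> j *\<^sub>R a j \<notin> (\<lambda>j. - a j) ` {..<m}"
    then show "\<epsilon> j *\<^sub>R a j \<in> a ` {..<m}" using \<epsilon>_cases[of j] J(1) by auto
  qed
  show "convex (convex hull ((\<lambda>j. \<epsilon> j *\<^sub>R a j) ` J))" by simp
  fix p q x
  assume p: "p \<in> cross_hull m a" and q: "q \<in> cross_hull m a"
    and x: "x \<in> convex hull ((\<lambda>j. \<epsilon> j *\<^sub>R a j) ` J)" and seg: "x \<in> open_segment p q"
  obtain \<alpha> where \<alpha>: "p = (\<Sum>j<m. \<alpha> j *\<^sub>R a j)" "(\<Sum>j<m. \<bar>\<alpha> j\<bar>) \<le> 1"
    using cross_hull_coeffs[OF p] by blast
  obtain \<beta> where \<beta>: "q = (\<Sum>j<m. \<beta> j *\<^sub>R a j)" "(\<Sum>j<m. \<bar>\<beta> j\<bar>) \<le> 1"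
    using cross_hull_coeffs[OF q] by blast
  obtain u where u: "0 < u" "u < 1" "x = (1 - u) *\<^sub>R p + u *\<^sub>R q"
    using seg by (auto simp: in_segment)
  obtain \<mu> where \<mu>: "\<And>j. j \<in> J \<Longrightarrow> 0 \<le> \<mu> j" "sum \<mu> J = 1" "x = (\<Sum>j\<in>J. \<mu> j *\<^sub>R \<epsilon> j *\<^sub>R a j)"
    using convex_hull_image_coeffs[OF finJ x] by blast
  define \<gamma> where "\<gamma> j = (1 - u) * \<alpha> j + u * \<beta> j" for j
  define \<eta> where "\<eta> j = \<gamma> j - (if j \<in> J then \<mu> j * \<epsilon> j else 0)" for j
  have split: "(\<Sum>j<m. f j) = (\<Sum>j\<in>J. f j) + (\<Sum>j\<in>{..<m}-J. f j)" for f :: "nat \<Rightarrow> real"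
    using sum.subset_diff[OF J(1), of f] by simp
  have \<gamma>1: "(\<Sum>j<m. \<bar>\<gamma> j\<bar>) \<le> 1"
  proof -
    have "(\<Sum>j<m. \<bar>\<gamma> j\<bar>) \<le> (\<Sum>j<m. (1 - u) * \<bar>\<alpha> j\<bar> + u * \<bar>\<beta> j\<bar>)"
    proof (rule sum_mono)
      fix j
      show "\<bar>\<gamma> j\<bar> \<le> (1 - u) * \<bar>\<alpha> j\<bar> + u * \<bar>\<beta> j\<bar>"
        using abs_triangle_ineq[of "(1 - u) * \<alpha> j" "u * \<beta> j"] u by (simp add: \<gamma>_def abs_mult)
    qed
    also have "\<dots> = (1 - u) * (\<Sum>j<m. \<bar>\<alpha> j\<bar>) + u * (\<Sum>j<m. \<bar>\<beta> j\<bar>)"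
      by (simp add: sum.distrib sum_distrib_left)
    also have "\<dots> \<le> (1 - u) * 1 + u * 1"
      using \<alpha> \<beta> u by (intro add_mono mult_left_mono) auto
    finally show ?thesis by simp
  qed
  have "(\<Sum>j<m. \<eta> j *\<^sub>R a j) = (\<Sum>j<m. \<gamma> j *\<^sub>R a j) - (\<Sum>j<m. (if j \<in> J then \<mu> j * \<epsilon> j else 0) *\<^sub>R a j)"
    unfolding \<eta>_def by (simp add: scaleR_diff_left sum_subtractf)
  also have "(\<Sum>j<m. \<gamma> j *\<^sub>R a j) = x"
    unfolding \<gamma>_def u(3) \<alpha>(1) \<beta>(1) by (simp add: scaleR_sum_right scaleR_add_left sum.distrib)
  also have "(\<Sum>j<m. (if j \<in> J then \<mu> j * \<epsilon> j else 0) *\<^sub>R a j) = (\<Sum>j\<in>J. \<mu> j *\<^sub>R \<epsilon> j *\<^sub>R a j)"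
    using J(1) by (intro sum.mono_neutral_cong_right) auto
  finally have ker: "(\<Sum>j<m. \<eta> j *\<^sub>R a j) = 0" using \<mu>(3) by simp
  \<comment> \<open>Off \<open>J\<close> the vector \<open>\<eta>\<close> equals
    \<open>\<gamma>\<close>, whose mass there is at most 1 minus its mass on \<open>J\<close>. As
    \<open>\<mu>\<close> sums to 1, this is at most the mass of \<open>\<eta>\<close> on
    \<open>J\<close>, against \<open>nsp\<close>.\<close>
  have \<eta>0: "\<eta> j = 0" if "j < m" for j
  proof (rule ccontr)
    assume "\<eta> j \<noteq> 0"
    from nspD[OF nsp ker that this J] have "(\<Sum>j\<in>J. \<bar>\<eta> j\<bar>) < (\<Sum>j\<in>{..<m}-J. \<bar>\<eta> j\<bar>)"
      using split[of "\<lambda>j. \<bar>\<eta> j\<bar>"] by simp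
    also have "\<dots> = (\<Sum>j\<in>{..<m}-J. \<bar>\<gamma> j\<bar>)" by (simp add: \<eta>_def)
    also have "\<dots> \<le> 1 - (\<Sum>j\<in>J. \<bar>\<gamma> j\<bar>)" using split[of "\<lambda>j. \<bar>\<gamma> j\<bar>"] \<gamma>1 by simp
    also have "\<dots> = (\<Sum>j\<in>J. \<mu> j - \<bar>\<gamma> j\<bar>)" using \<mu>(2) by (simp add: sum_subtractf)
    also have "\<dots> \<le> (\<Sum>j\<in>J. \<bar>\<eta> j\<bar>)"
    proof (rule sum_mono)
      fix j assume j: "j \<in> J"
      show "\<mu> j - \<bar>\<gamma> j\<bar> \<le> \<bar>\<eta> j\<bar>"
        using \<epsilon>_cases[OF j] \<mu>(1)[OF j] j by (auto simp: \<eta>_def)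
    qed
    finally show False by simp
  qed
  have \<gamma>J: "\<epsilon> j * \<gamma> j = \<mu> j" if "j \<in> J" for j
    using \<eta>0[of j] that J(1) \<epsilon>_cases[OF that] by (auto simp: \<eta>_def)
  have sum1: "(1 - u) * (\<Sum>j\<in>J. \<epsilon> j * \<alpha> j) + u * (\<Sum>j\<in>J. \<epsilon> j * \<beta> j) = 1"
  proof -
    have "(1 - u) * (\<Sum>j\<in>J. \<epsilon> j * \<alpha> j) + u * (\<Sum>j\<in>J. \<epsilon> j * \<beta> j) = (\<Sum>j\<in>J. \<epsilon> j * \<gamma> j)"
      by (simp add: \<gamma>_def sum_distrib_left algebra_simps flip: sum.distrib)
    then show ?thesis using \<gamma>J \<mu>(2) by simp
  qed
  have le: "(\<Sum>j\<in>J. \<epsilon> j * c j) \<le> (\<Sum>j\<in>J. \<bar>c j\<bar>)" for c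
    using \<epsilon>_cases by (intro sum_mono) force
  have nn: "0 \<le> (\<Sum>j\<in>{..<m}-J. \<bar>c j\<bar>)" for c :: "nat \<Rightarrow> real"
    by (intro sum_nonneg) auto
  \<comment> \<open>The signed sum over \<open>J\<close> is at most the mass on \<open>J\<close>,
    which is at most 1. Equality throughout makes \<open>c\<close> vanish off \<open>J\<close> and
    carry the signs \<open>\<epsilon>\<close> on \<open>J\<close>.\<close>
  have in_face: "(\<Sum>j<m. c j *\<^sub>R a j) \<in> convex hull ((\<lambda>j. \<epsilon> j *\<^sub>R a j) ` J)"
    if c: "(\<Sum>j<m. \<bar>c j\<bar>) \<le> 1" "(\<Sum>j\<in>J. \<epsilon> j * c j) \<ge> 1" for c
  proof -
    have s: "(\<Sum>j\<in>J. \<epsilon> j * c j) = (\<Sum>j\<in>J. \<bar>c j\<bar>)" "(\<Sum>j\<in>{..<m}-J. \<bar>c j\<bar>) = 0"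
      "(\<Sum>j\<in>J. \<epsilon> j * c j) = 1"
      using c split[of "\<lambda>j. \<bar>c j\<bar>"] le[of c] nn[of c] by linarith+
    have off: "c j = 0" if "j \<in> {..<m} - J" for j
      using s(2) that by (subst (asm) sum_nonneg_eq_0_iff) auto
    have "(\<Sum>j\<in>J. \<bar>c j\<bar> - \<epsilon> j * c j) = 0" using s(1) by (simp add: sum_subtractf)
    then have on: "\<epsilon> j * c j = \<bar>c j\<bar>" if "j \<in> J" for j
      using that \<epsilon>_cases finJ by (subst (asm) sum_nonneg_eq_0_iff) force+
    have "(\<Sum>j<m. c j *\<^sub>R a j) = (\<Sum>j\<in>J. c j *\<^sub>R a j)"
      using J(1) off by (intro sum.mono_neutral_right) auto
    also have "\<dots> = (\<Sum>j\<in>J. (\<epsilon> j * c j) *\<^sub>R \<epsilon> j *\<^sub>R a j)"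
      using \<epsilon>_cases by (intro sum.cong) force+
    also have "\<dots> \<in> convex hull ((\<lambda>j. \<epsilon> j *\<^sub>R a j) ` J)"
      using s(3) on finJ by (intro convex_sum) (auto intro: hull_inc)
    finally show ?thesis .
  qed
  \<comment> \<open>The signed sum is at most 1 at \<open>\<alpha>\<close> and at
    \<open>\<beta>\<close>, and a proper weighted mean of the two values is 1 by
    \<open>sum1\<close>; so both are 1.\<close>
  have sa: "(\<Sum>j\<in>J. \<epsilon> j * \<alpha> j) \<le> 1" and sb: "(\<Sum>j\<in>J. \<epsilon> j * \<beta> j) \<le> 1"
    using le[of \<alpha>] le[of \<beta>] \<alpha>(2) \<beta>(2) split[of "\<lambda>j. \<bar>\<alpha> j\<bar>"] split[of "\<lambda>j. \<bar>\<beta> j\<bar>"]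
      nn[of \<alpha>] nn[of \<beta>] by linarith+
  have "(\<Sum>j\<in>J. \<epsilon> j * \<alpha> j) \<ge> 1"
  proof (rule ccontr)
    assume "\<not> ?thesis"
    then have "(1 - u) * (\<Sum>j\<in>J. \<epsilon> j * \<alpha> j) + u * (\<Sum>j\<in>J. \<epsilon> j * \<beta> j) < (1 - u) * 1 + u * 1"
      using sb u by (intro add_less_le_mono mult_strict_left_mono mult_left_mono) auto
    then show False using sum1 by simp
  qed
  then show "p \<in> convex hull ((\<lambda>j. \<epsilon> j *\<^sub>R a j) ` J)" using in_face \<alpha> by simp
  have "(\<Sum>j\<in>J. \<epsilon> j * \<beta> j) \<ge> 1"
  proof (rule ccontr)
    assume "\<not> ?thesis"
    then have "(1 - u) * (\<Sum>j\<in>J. \<epsilon> j * \<alpha> j) + u * (\<Sum>j\<in>J. \<epsilon> j * \<beta> j) < (1 - u) * 1 + u * 1"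
      using sa u by (intro add_le_less_mono mult_strict_left_mono mult_left_mono) auto
    then show False using sum1 by simp
  qed
  then show "q \<in> convex hull ((\<lambda>j. \<epsilon> j *\<^sub>R a j) ` J)" using in_face \<beta> by simp
qed

lemma nsp_mono: "nsp k m a \<Longrightarrow> k' \<le> k \<Longrightarrow> nsp k' m a"
  unfolding nsp_def by (meson le_trans)

text \<open>A coincidence would give a kernel vector with a single nonzero entry or with two entries
  of modulus 1, so one coordinate would carry half of the mass.\<close>

lemma nsp_signed_inj:
  fixes a :: "nat \<Rightarrow> 'a::real_vector" and e e' :: real
  assumes nsp: "nsp k m a" and k: "1 \<le> k" and ij: "i < m" "j < m" and e: "\<bar>e\<bar> = 1" "\<bar>e'\<bar> = 1"
    and eq: "e *\<^sub>R a i = e' *\<^sub>R a j"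
  shows "i = j \<and> e = e'"
proof (rule ccontr)
  assume neg: "\<not> (i = j \<and> e = e')"
  define h where "h l = (if l = i then e else 0) - (if l = j then e' else 0)" for l
  have hi: "h i \<noteq> 0" using neg e by (auto simp: h_def)
  have "(\<Sum>l<m. h l *\<^sub>R a l)
      = (\<Sum>l<m. (if l = i then e *\<^sub>R a i else 0)) - (\<Sum>l<m. (if l = j then e' *\<^sub>R a j else 0))"
    unfolding sum_subtractf[symmetric] by (intro sum.cong) (auto simp: h_def scaleR_diff_left)
  also have "\<dots> = 0" using eq ij by simp
  finally have "(\<Sum>l<m. h l *\<^sub>R a l) = 0" .
  from nspD[OF nsp this ij(1) hi, of "{i}"] ij k
  have "2 * \<bar>h i\<bar> < (\<Sum>l<m. \<bar>h l\<bar>)" by simp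
  also have "\<dots> \<le> 2 * \<bar>h i\<bar>"
  proof (cases "i = j")
    case True
    have "(\<Sum>l<m. \<bar>h l\<bar>) = (\<Sum>l<m. if l = i then \<bar>h i\<bar> else 0)"
      using True by (intro sum.cong) (auto simp: h_def)
    then show ?thesis using ij by simp
  next
    case False
    have "(\<Sum>l<m. \<bar>h l\<bar>) = (\<Sum>l<m. (if l = i then 1 else 0) + (if l = j then 1 else 0))"
      using False e by (intro sum.cong) (auto simp: h_def)
    also have "\<dots> = 2" using ij by (simp add: sum.distrib)
    finally show ?thesis using False e by (simp add: h_def)
  qed
  finally show False by simp
qed

lemma vertices_cross_hull:
  fixes a :: "nat \<Rightarrow> 'a::real_vector"
  assumes nsp: "nsp k m a" and k: "1 \<le> k"
  shows "vertices (cross_hull m a) = a ` {..<m} \<union> (\<lambda>j. - a j) ` {..<m}"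
proof
  show "vertices (cross_hull m a) \<subseteq> a ` {..<m} \<union> (\<lambda>j. - a j) ` {..<m}"
    unfolding vertices_def cross_hull_def by (rule extreme_points_of_convex_hull)
  have "e *\<^sub>R a j extreme_point_of cross_hull m a" if "j < m" "\<bar>e\<bar> = 1" for j e
    using signed_hull_face[OF nsp, of "{j}" "\<lambda>_. e"] that k by (simp add: face_of_singleton)
  from this[of _ 1] this[of _ "-1"]
  show "a ` {..<m} \<union> (\<lambda>j. - a j) ` {..<m} \<subseteq> vertices (cross_hull m a)"
    unfolding vertices_def by auto
qed

lemma card_vertices_cross_hull:
  fixes a :: "nat \<Rightarrow> 'a::real_vector"
  assumes nsp: "nsp k m a" and k: "1 \<le> k"
  shows "card (vertices (cross_hull m a)) = 2 * m"
proof -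
  note inj = nsp_signed_inj[OF nsp k]
  have "inj_on a {..<m}"
    using inj[of _ _ 1 1] by (intro inj_onI) auto
  moreover have "inj_on (\<lambda>j. - a j) {..<m}"
    using inj[of _ _ 1 1] by (intro inj_onI) auto
  moreover have "a ` {..<m} \<inter> (\<lambda>j. - a j) ` {..<m} = {}"
    using inj[of _ _ 1 "-1"] by force
  ultimately show ?thesis
    by (simp add: vertices_cross_hull[OF assms] card_Un_disjoint card_image)
qed

lemma neighborly_cross_hull:
  fixes a :: "nat \<Rightarrow> 'a::real_vector"
  assumes nsp: "nsp k m a" and k: "1 \<le> k" "k \<le> m"
  shows "neighborly k (cross_hull m a)"
  unfolding neighborly_def
proof (intro conjI allI impI)
  show "1 \<le> k" "2 * k \<le> card (vertices (cross_hull m a))"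
    using k card_vertices_cross_hull[OF nsp] by auto
  fix S assume S: "S \<subseteq> vertices (cross_hull m a) \<and> card S = k \<and> pairwise (\<lambda>u v. u \<noteq> - v) S"
  note inj = nsp_signed_inj[OF nsp k(1)]
  note V = vertices_cross_hull[OF nsp k(1)]
  define J where "J = {j. j < m \<and> (a j \<in> S \<or> - a j \<in> S)}"
  define \<epsilon> :: "nat \<Rightarrow> real" where "\<epsilon> j = (if a j \<in> S then 1 else -1)" for j
  define f where "f j = \<epsilon> j *\<^sub>R a j" for j
  have \<epsilon>: "\<bar>\<epsilon> j\<bar> = 1" for j by (simp add: \<epsilon>_def)
  \<comment> \<open>\<open>pairwise\<close> compares distinct elements only, so it forbids having
    both \<open>a j\<close> and \<open>- a j\<close> in \<open>S\<close> only once they are known to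
    differ.\<close>
  have neq: "a j \<noteq> - a j" if "j < m" for j using inj[of j j 1 "-1"] that by auto
  have SJ: "S = f ` J"
  proof
    show "f ` J \<subseteq> S" by (auto simp: J_def f_def \<epsilon>_def)
    show "S \<subseteq> f ` J"
    proof
      fix v assume v: "v \<in> S"
      then obtain j where j: "j < m" "v = a j \<or> v = - a j" using S V by auto
      have "v = f j"
      proof (cases "v = a j")
        case True
        then show ?thesis using v by (simp add: f_def \<epsilon>_def)
      next
        case False
        then have vj: "v = - a j" using j by simp
        have "a j \<notin> S"
        proof
          assume "a j \<in> S"
          with v S neq[OF j(1)] vj show False unfolding pairwise_def by fastforce
        qed
        then show ?thesis using vj by (simp add: f_def \<epsilon>_def)
      qed
      moreover have "j \<in> J" using j v by (auto simp: J_def)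
      ultimately show "v \<in> f ` J" by blast
    qed
  qed
  have "inj_on f J"
  proof (rule inj_onI)
    fix i j assume "i \<in> J" "j \<in> J" "f i = f j"
    then show "i = j" using inj[of i j "\<epsilon> i" "\<epsilon> j"] \<epsilon> by (auto simp: f_def J_def)
  qed
  then have "card J = k" using S SJ by (simp add: card_image)
  then have F: "convex hull S face_of cross_hull m a"
    unfolding SJ f_def by (intro signed_hull_face[OF nsp]) (auto simp: J_def \<epsilon>)
  have "vertices (convex hull S) = S"
  proof
    show "vertices (convex hull S) \<subseteq> S"
      unfolding vertices_def by (rule extreme_points_of_convex_hull)
    show "S \<subseteq> vertices (convex hull S)"
      using S extreme_point_of_face[OF F] unfolding vertices_def by (auto intro: hull_inc)
  qed
  with F show "\<exists>F. F face_of cross_hull m a \<and> vertices F = S" by blast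
qed

section \<open>Coordinates in \<open>euclid d\<close> and full-dimensional cross-polytopes\<close>

lemma lookup_scaleR: "Poly_Mapping.lookup (c *\<^sub>R (x::rvec)) i = c * Poly_Mapping.lookup x i"
proof -
  have "finite {i. c * Poly_Mapping.lookup x i \<noteq> 0}"
    by (rule finite_subset[OF _ finite_lookup[of x]]) auto
  then show ?thesis by (simp add: scaleR_poly_mapping_def)
qed

lemma subspace_euclid: "subspace (euclid d)"
  unfolding euclid_def subspace_def
  by (auto simp: in_keys_iff lookup_scaleR dest!: subsetD[OF keys_add])

abbreviation unit_vec :: "nat \<Rightarrow> rvec" where "unit_vec i \<equiv> Poly_Mapping.single i 1"


lemma euclid_expand:
  assumes "x \<in> euclid d"
  shows "x = (\<Sum>i<d. Poly_Mapping.lookup x i *\<^sub>R unit_vec i)"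
proof (rule poly_mapping_eqI)
  fix i
  have "Poly_Mapping.lookup (\<Sum>i<d. Poly_Mapping.lookup x i *\<^sub>R unit_vec i) i = (\<Sum>j<d. if j = i then Poly_Mapping.lookup x i else 0)"
    unfolding lookup_sum by (intro sum.cong) (auto simp: lookup_scaleR lookup_single when_def)
  also have "\<dots> = Poly_Mapping.lookup x i"
    using assms by (auto simp: euclid_def in_keys_iff)
  finally show "Poly_Mapping.lookup x i = Poly_Mapping.lookup (\<Sum>i<d. Poly_Mapping.lookup x i *\<^sub>R unit_vec i) i" ..
qed

lemma unit_vec_in_euclid: "i < d \<Longrightarrow> unit_vec i \<in> euclid d"
  by (simp add: euclid_def)

lemma span_unit_vecs: "span (unit_vec ` {..<d}) = euclid d"
proof
  show "span (unit_vec ` {..<d}) \<subseteq> euclid d"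
    by (intro span_minimal subspace_euclid) (auto simp: unit_vec_in_euclid)
  show "euclid d \<subseteq> span (unit_vec ` {..<d})"
  proof
    fix x assume "x \<in> euclid d"
    then show "x \<in> span (unit_vec ` {..<d})"
      using euclid_expand by (metis (no_types, lifting) imageI span_base span_mul span_sum)
  qed
qed

lemma inj_unit_vec: "inj_on unit_vec A"
  by (rule inj_onI) (metis keys_single singleton_inject zero_neq_one)

lemma independent_unit_vecs: "independent (unit_vec ` {..<d})"
proof (rule independent_if_scalars_zero)
  fix f :: "rvec \<Rightarrow> real" and x
  assume s: "(\<Sum>x\<in>unit_vec ` {..<d}. f x *\<^sub>R x) = 0" and x: "x \<in> unit_vec ` {..<d}"
  then obtain i where i: "i < d" "x = unit_vec i" by auto
  have "0 = Poly_Mapping.lookup (\<Sum>j<d. f (unit_vec j) *\<^sub>R unit_vec j) i"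
    using s by (simp add: sum.reindex[OF inj_unit_vec])
  also have "\<dots> = (\<Sum>j<d. if j = i then f x else 0)"
    unfolding lookup_sum using i by (intro sum.cong) (auto simp: lookup_scaleR lookup_single when_def)
  finally show "f x = 0" using i by simp
qed auto

text \<open>The body contains 0, so its affine hull is its span; the origin with the unit vectors is
  the affine basis for \<open>has_aff_dim\<close>.\<close>

lemma cs_polytope_cross_hull:
  assumes a: "span (a ` {..<m}) = euclid d" and m: "0 < m"
  shows "cs_polytope d (cross_hull m a)"
  unfolding cs_polytope_def
proof (intro conjI ballI)
  let ?V = "a ` {..<m} \<union> (\<lambda>j. - a j) ` {..<m}"
  let ?E = "unit_vec ` {..<d}"
  have aE: "a j \<in> euclid d" if "j < m" for j by (metis a image_eqI lessThan_iff span_base that)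
  show sub: "cross_hull m a \<subseteq> euclid d"
    unfolding cross_hull_def
  proof (rule hull_minimal)
    show "?V \<subseteq> euclid d" using aE subspace_neg[OF subspace_euclid] by auto
  qed (rule subspace_imp_convex[OF subspace_euclid])
  show "polytope (cross_hull m a)"
    unfolding cross_hull_def by (intro polytope_convex_hull) auto
  show "- x \<in> cross_hull m a" if "x \<in> cross_hull m a" for x
    by (rule cross_hull_minus[OF that])
  have a_in: "a j \<in> cross_hull m a" if "j < m" for j
    using that unfolding cross_hull_def by (auto intro: hull_inc)
  have zero: "0 \<in> cross_hull m a"
  proof -
    have "(1/2) *\<^sub>R a 0 + (1/2) *\<^sub>R (- a 0) \<in> cross_hull m a"
      using a_in[OF m] cross_hull_minus[OF a_in[OF m]]
      unfolding cross_hull_def by (intro convexD) auto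
    then show ?thesis by simp
  qed
  have "affine hull cross_hull m a = span (cross_hull m a)"
    using zero by (intro affine_hull_span_0 hull_inc)
  also have "\<dots> = euclid d"
  proof
    show "span (cross_hull m a) \<subseteq> euclid d"
      using sub subspace_euclid by (rule span_minimal)
    show "euclid d \<subseteq> span (cross_hull m a)"
      unfolding a[symmetric] using a_in by (intro span_mono) auto
  qed
  also have "\<dots> = affine hull insert 0 ?E"
  proof -
    have "affine hull insert 0 ?E = span (insert 0 ?E)"
      by (intro affine_hull_span_0 hull_inc) auto
    then show ?thesis by (simp add: span_unit_vecs)
  qed
  finally have 1: "affine hull insert 0 ?E = affine hull cross_hull m a" ..
  have n0: "0 \<notin> ?E" by (metis dependent_zero independent_unit_vecs)
  then have 2: "\<not> affine_dependent (insert 0 ?E)"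
    using independent_unit_vecs by (subst affine_dependent_iff_dependent) auto
  have 3: "card (insert 0 ?E) = d + 1"
    using n0 by (simp add: card_image[OF inj_unit_vec])
  show "has_aff_dim (cross_hull m a) d"
    unfolding has_aff_dim_def using 1 2 3 by blast
qed

text \<open>Adding vectors of a complement of the column space to superfluous columns can only shrink the kernel.\<close>

lemma nsp_spanning:
  fixes a :: "nat \<Rightarrow> rvec"
  assumes nsp: "nsp k m a" and a: "\<And>j. j < m \<Longrightarrow> a j \<in> euclid d" and d: "d \<le> m"
  obtains b where "nsp k m b" "span (b ` {..<m}) = euclid d"
proof -
  let ?A = "a ` {..<m}"
  obtain B where B: "B \<subseteq> ?A" "independent B" "?A \<subseteq> span B"
    using maximal_independent_subset by blast
  have "B \<subseteq> euclid d" using B(1) a by auto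
  then obtain D where D: "B \<subseteq> D" "D \<subseteq> euclid d" "independent D" "euclid d \<subseteq> span D"
    using maximal_independent_subset_extend[OF _ B(2)] by blast
  have "finite D \<and> card D \<le> card (unit_vec ` {..<d})"
    using D(2,3) by (intro independent_span_bound) (auto simp: span_unit_vecs)
  then have finD: "finite D" "card D \<le> d" by (auto simp: card_image[OF inj_unit_vec])
  have finB: "finite B" using D(1) finD(1) by (rule finite_subset)
  define C where "C = D - B"
  have "\<forall>v\<in>B. \<exists>j<m. a j = v" using B(1) by auto
  then obtain g where g: "\<And>v. v \<in> B \<Longrightarrow> g v < m \<and> a (g v) = v" by metis
  have "card ({..<m} - g ` B) = m - card (g ` B)"
    using finB g by (subst card_Diff_subset) auto
  moreover have "card (g ` B) \<le> card B" using finB by (rule card_image_le)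
  moreover have "card C = card D - card B"
    unfolding C_def using finB D(1) by (rule card_Diff_subset)
  ultimately have "card C \<le> card ({..<m} - g ` B)" using finD(2) d by linarith
  \<comment> \<open>\<open>\<phi>\<close> places the vectors of the complement \<open>C\<close> on
    columns outside the chosen column basis; \<open>d \<le> m\<close> leaves enough of them.\<close>
  then obtain \<phi> where \<phi>: "inj_on \<phi> C" "\<phi> ` C \<subseteq> {..<m} - g ` B"
    using card_le_inj[of C "{..<m} - g ` B"] finD(1) by (auto simp: C_def)
  define b where "b j = a j + (if j \<in> \<phi> ` C then inv_into C \<phi> j else 0)" for j
  have b\<phi>: "b (\<phi> c) = a (\<phi> c) + c" if "c \<in> C" for c
    using that \<phi>(1) by (simp add: b_def)
  have bg: "b (g v) = v" if "v \<in> B" for v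
  proof -
    have "g v \<notin> \<phi> ` C" using \<phi>(2) that by blast
    then show ?thesis using g[OF that] by (simp add: b_def)
  qed
  \<comment> \<open>The projection onto \<open>span B\<close> that kills \<open>C\<close> turns the
    new columns back into the old ones, so every kernel vector of \<open>b\<close> is one of
    \<open>a\<close>.\<close>
  obtain p where p: "linear p" "\<And>x. x \<in> D \<Longrightarrow> p x = (if x \<in> B then x else 0)"
    using linear_independent_extend[OF D(3), of "\<lambda>x. if x \<in> B then x else 0"] by blast
  have pid: "p x = id x" if "x \<in> span B" for x
  proof (rule linear_eq_on_span[OF p(1) linear_id _ that])
    fix v assume "v \<in> B"
    then show "p v = id v" using p(2)[of v] D(1) by auto
  qed
  have pb: "p (b j) = a j" if "j < m" for j
  proof -
    have "p (a j) = a j" using pid[of "a j"] B(3) that by auto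
    moreover have "p (inv_into C \<phi> j) = 0" if "j \<in> \<phi> ` C"
      using inv_into_into[OF that] p(2) by (auto simp: C_def)
    ultimately show ?thesis using p(1) by (auto simp: b_def linear_add linear_0)
  qed
  have nspb: "nsp k m b"
    unfolding nsp_def
  proof (intro allI impI, elim conjE)
    fix h :: "nat \<Rightarrow> real" and S
    assume h: "(\<Sum>j<m. h j *\<^sub>R b j) = 0" "\<exists>j<m. h j \<noteq> 0" "S \<subseteq> {..<m}" "card S \<le> k"
    have "(\<Sum>j<m. h j *\<^sub>R a j) = (\<Sum>j<m. h j *\<^sub>R p (b j))" using pb by (intro sum.cong) auto
    also have "\<dots> = p (\<Sum>j<m. h j *\<^sub>R b j)" using p(1) by (simp add: linear_sum linear_scale)
    also have "\<dots> = 0" using h(1) p(1) by (simp add: linear_0)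
    finally show "2 * (\<Sum>j\<in>S. \<bar>h j\<bar>) < (\<Sum>j<m. \<bar>h j\<bar>)"
      using nsp h unfolding nsp_def by blast
  qed
  have CE: "C \<subseteq> euclid d" using D(2) by (auto simp: C_def)
  have bE: "b j \<in> euclid d" if "j < m" for j
  proof -
    have "inv_into C \<phi> j \<in> euclid d" if "j \<in> \<phi> ` C"
      using inv_into_into[OF that] CE by auto
    then show ?thesis
      using a[OF that] subspace_add[OF subspace_euclid] subspace_0[OF subspace_euclid] by (auto simp: b_def)
  qed
  have "span (b ` {..<m}) = euclid d"
  proof
    show "span (b ` {..<m}) \<subseteq> euclid d"
      using bE by (intro span_minimal subspace_euclid) auto
    have Bs: "B \<subseteq> span (b ` {..<m})"
    proof
      fix v assume "v \<in> B"
      then show "v \<in> span (b ` {..<m})"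
        using bg g by (metis image_eqI lessThan_iff span_base)
    qed
    have "c \<in> span (b ` {..<m})" if c: "c \<in> C" for c
    proof -
      have lt: "\<phi> c < m" using \<phi>(2) c by auto
      have "a (\<phi> c) \<in> span (b ` {..<m})"
        using B(3) lt span_minimal[OF Bs subspace_span] by auto
      moreover have "b (\<phi> c) \<in> span (b ` {..<m})" using lt by (intro span_base) auto
      ultimately have "b (\<phi> c) - a (\<phi> c) \<in> span (b ` {..<m})" by (metis span_diff)
      then show ?thesis using b\<phi>[OF c] by simp
    qed
    then have "D \<subseteq> span (b ` {..<m})" using Bs by (auto simp: C_def)
    then show "euclid d \<subseteq> span (b ` {..<m})"
      using D(4) span_minimal[OF _ subspace_span] by blast
  qed
  with nspb that show thesis by blast
qed

lemma cs_neighborly_exists: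
  fixes a :: "nat \<Rightarrow> rvec"
  assumes "nsp k m a" "\<And>j. j < m \<Longrightarrow> a j \<in> euclid d" "0 < d" "d \<le> m" "1 \<le> k" "k \<le> m"
  obtains P where "cs_polytope d P" "card (vertices P) = 2 * m"
    "\<And>k'. 1 \<le> k' \<Longrightarrow> k' \<le> k \<Longrightarrow> neighborly k' P"
proof -
  obtain b :: "nat \<Rightarrow> rvec" where b: "nsp k m b" "span (b ` {..<m}) = euclid d"
    using nsp_spanning[of k m a d] assms by blast
  show thesis
  proof (rule that)
    show "cs_polytope d (cross_hull m b)"
      using b(2) assms by (intro cs_polytope_cross_hull) auto
    show "card (vertices (cross_hull m b)) = 2 * m"
      using b(1) assms(5) by (rule card_vertices_cross_hull)
    show "neighborly k' (cross_hull m b)" if "1 \<le> k'" "k' \<le> k" for k'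
      using nsp_mono[OF b(1)] that assms(6) by (intro neighborly_cross_hull) auto
  qed
qed

section \<open>The null space property in coordinates, and points on a circle\<close>

lemma nsp_columns:
  fixes A :: "nat \<Rightarrow> nat \<Rightarrow> real"
  assumes "\<And>h S. (\<And>i. i < d \<Longrightarrow> (\<Sum>j<m. h j * A i j) = 0) \<Longrightarrow> \<exists>j<m. h j \<noteq> 0 \<Longrightarrow>
      S \<subseteq> {..<m} \<Longrightarrow> card S \<le> k \<Longrightarrow> 2 * (\<Sum>j\<in>S. \<bar>h j\<bar>) < (\<Sum>j<m. \<bar>h j\<bar>)"
  shows "nsp k m (\<lambda>j. \<Sum>i<d. A i j *\<^sub>R unit_vec i)"
  unfolding nsp_def
proof (intro allI impI, elim conjE)
  fix h :: "nat \<Rightarrow> real" and S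
  assume h: "(\<Sum>j<m. h j *\<^sub>R (\<Sum>i<d. A i j *\<^sub>R unit_vec i)) = 0" "\<exists>j<m. h j \<noteq> 0" "S \<subseteq> {..<m}" "card S \<le> k"
  have l: "Poly_Mapping.lookup (\<Sum>i<d. A i j *\<^sub>R unit_vec i) l = A l j" if "l < d" for j l
  proof -
    have "Poly_Mapping.lookup (\<Sum>i<d. A i j *\<^sub>R unit_vec i) l = (\<Sum>i<d. if i = l then A l j else 0)"
      unfolding lookup_sum by (intro sum.cong) (auto simp: lookup_scaleR lookup_single when_def)
    then show ?thesis using that by simp
  qed
  show "2 * (\<Sum>j\<in>S. \<bar>h j\<bar>) < (\<Sum>j<m. \<bar>h j\<bar>)"
  proof (rule assms[OF _ h(2-4)])
    fix i assume i: "i < d"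
    have "(\<Sum>j<m. h j * A i j) = Poly_Mapping.lookup (\<Sum>j<m. h j *\<^sub>R (\<Sum>i<d. A i j *\<^sub>R unit_vec i)) i"
      by (simp add: lookup_sum[of _ "{..<m}"] lookup_scaleR l[OF i])
    then show "(\<Sum>j<m. h j * A i j) = 0" using h(1) by simp
  qed
qed

lemma column_in_euclid: "(\<Sum>i<d. A i *\<^sub>R unit_vec i) \<in> euclid d"
  by (intro subspace_sum subspace_mul subspace_euclid) (auto simp: unit_vec_in_euclid)

text \<open>Pairing a kernel relation with column \<open>l\<close> expresses \<open>h l\<close>
  through the other entries with factors of modulus below 1, so no entry reaches half of the
  mass.\<close>

lemma nsp_1_of_gram:
  fixes A :: "nat \<Rightarrow> nat \<Rightarrow> real"
  assumes diag: "\<And>j. j < m \<Longrightarrow> (\<Sum>i<d. A i j * A i j) = 1"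
    and off: "\<And>j l. j < m \<Longrightarrow> l < m \<Longrightarrow> j \<noteq> l \<Longrightarrow> \<bar>\<Sum>i<d. A i j * A i l\<bar> < 1"
  shows "nsp 1 m (\<lambda>j. \<Sum>i<d. A i j *\<^sub>R unit_vec i)"
proof (rule nsp_columns)
  fix h :: "nat \<Rightarrow> real" and S
  assume ker: "\<And>i. i < d \<Longrightarrow> (\<Sum>j<m. h j * A i j) = 0" and h: "\<exists>j<m. h j \<noteq> 0"
    and S: "S \<subseteq> {..<m}" "card S \<le> 1"
  have pos: "0 < (\<Sum>j<m. \<bar>h j\<bar>)" using h by (auto intro!: sum_pos2)
  show "2 * (\<Sum>j\<in>S. \<bar>h j\<bar>) < (\<Sum>j<m. \<bar>h j\<bar>)"
  proof (cases "S = {}")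
    case True
    then show ?thesis using pos by simp
  next
    case False
    moreover have "finite S" using S finite_subset by blast
    ultimately have "card S = 1" using S(2) by (simp add: card_gt_0_iff Suc_le_eq order_antisym)
    then obtain l where l: "S = {l}" by (auto simp: card_1_singleton_iff)
    with S have lm: "l < m" by simp
    let ?G = "\<lambda>j. \<Sum>i<d. A i j * A i l"
    have "0 = (\<Sum>i<d. (\<Sum>j<m. h j * A i j) * A i l)" using ker by simp
    also have "\<dots> = (\<Sum>j<m. h j * ?G j)"
      unfolding sum_distrib_left sum_distrib_right by (subst sum.swap) (simp add: mult.assoc)
    also have "\<dots> = h l + (\<Sum>j\<in>{..<m}-{l}. h j * ?G j)"
      using lm diag by (subst sum.remove[of _ l]) auto
    finally have hl: "\<bar>h l\<bar> = \<bar>\<Sum>j\<in>{..<m}-{l}. h j * ?G j\<bar>" by linarith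
    have split: "(\<Sum>j<m. \<bar>h j\<bar>) = \<bar>h l\<bar> + (\<Sum>j\<in>{..<m}-{l}. \<bar>h j\<bar>)"
      using lm by (subst sum.remove[of _ l]) auto
    have le: "\<bar>h j * ?G j\<bar> \<le> \<bar>h j\<bar>" if "j \<in> {..<m}-{l}" for j
      using off[of j l] that lm by (simp add: abs_mult mult_left_le)
    have "\<bar>h l\<bar> < (\<Sum>j\<in>{..<m}-{l}. \<bar>h j\<bar>)"
    proof (cases "\<exists>j\<in>{..<m}-{l}. h j \<noteq> 0")
      case True
      then obtain j where j: "j \<in> {..<m}-{l}" "h j \<noteq> 0" by blast
      have "\<bar>h l\<bar> \<le> (\<Sum>j\<in>{..<m}-{l}. \<bar>h j * ?G j\<bar>)" unfolding hl by (rule sum_abs)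
      also have "\<dots> < (\<Sum>j\<in>{..<m}-{l}. \<bar>h j\<bar>)"
      proof (rule sum_strict_mono_ex1)
        have "\<bar>h j\<bar> * \<bar>?G j\<bar> < \<bar>h j\<bar> * 1"
          using off[of j l] j lm by (intro mult_strict_left_mono) auto
        then show "\<exists>j\<in>{..<m}-{l}. \<bar>h j * ?G j\<bar> < \<bar>h j\<bar>" using j(1) by (auto simp: abs_mult)
      qed (use le in auto)
      finally show ?thesis .
    next
      case False
      then have "(\<Sum>j\<in>{..<m}-{l}. \<bar>h j\<bar>) = 0" "\<bar>h l\<bar> = 0" unfolding hl by simp_all
      then show ?thesis using split pos by linarith
    qed
    then show ?thesis using split l by simp
  qed
qed

text \<open>The quotient is the inner product of two points of the unit circle in rational
  parametrisation; for nonnegative parameters they are never antipodal.\<close>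

lemma circle_gram_bound:
  fixes x y :: real
  assumes "0 \<le> x" "0 \<le> y" "x \<noteq> y"
  shows "\<bar>((1 - x\<^sup>2) * (1 - y\<^sup>2) + 4 * x * y) / ((1 + x\<^sup>2) * (1 + y\<^sup>2))\<bar> < 1"
proof -
  let ?N = "(1 - x\<^sup>2) * (1 - y\<^sup>2) + 4 * x * y" and ?D = "(1 + x\<^sup>2) * (1 + y\<^sup>2)"
  have "?D > 0" by (intro mult_pos_pos add_pos_nonneg) auto
  moreover have "?D - ?N = 2 * (x - y)\<^sup>2" by (simp add: power2_eq_square algebra_simps)
  moreover have "(x - y)\<^sup>2 > 0" using assms by simp
  moreover have "?D + ?N = 2 * (1 + x * y)\<^sup>2" by (simp add: power2_eq_square algebra_simps)
  moreover have "(1 + x * y)\<^sup>2 > 0"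
    using assms by (intro zero_less_power add_pos_nonneg mult_nonneg_nonneg) auto
  ultimately have "\<bar>?N\<bar> < ?D" "?D > 0" by linarith+
  then show ?thesis by (simp only: abs_divide divide_less_eq_1_pos abs_of_pos)
qed

lemma nsp_1_exists:
  assumes "2 \<le> d"
  obtains a :: "nat \<Rightarrow> rvec" where "nsp 1 m a" "\<And>j. a j \<in> euclid d"
proof -
  \<comment> \<open>Column \<open>j\<close> is the rational circle point with parameter
    \<open>j\<close>. All columns lie in one plane; \<open>nsp_spanning\<close> later makes them
    span.\<close>
  define A :: "nat \<Rightarrow> nat \<Rightarrow> real" where
    "A i j = (if i = 0 then 1 - (real j)\<^sup>2 else 2 * real j) / (1 + (real j)\<^sup>2)" for i j
  have nz: "1 + (real j)\<^sup>2 \<noteq> 0" for j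
    using zero_le_power2[of "real j"] by linarith
  have G: "(\<Sum>i<2. A i j * A i l) = ((1 - (real j)\<^sup>2) * (1 - (real l)\<^sup>2) + 4 * real j * real l)
      / ((1 + (real j)\<^sup>2) * (1 + (real l)\<^sup>2))" for j l
    by (simp add: A_def numeral_2_eq_2 add_divide_distrib)
  have "nsp 1 m (\<lambda>j. \<Sum>i<2. A i j *\<^sub>R unit_vec i)"
  proof (rule nsp_1_of_gram)
    fix j l :: nat
    have "(1 - (real j)\<^sup>2) * (1 - (real j)\<^sup>2) + 4 * real j * real j = (1 + (real j)\<^sup>2) * (1 + (real j)\<^sup>2)"
      by (simp add: power2_eq_square algebra_simps)
    then show "(\<Sum>i<2. A i j * A i j) = 1"
      unfolding G using nz[of j] by simp
    assume "j \<noteq> l"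
    then show "\<bar>\<Sum>i<2. A i j * A i l\<bar> < 1"
      unfolding G by (intro circle_gram_bound) auto
  qed
  moreover have "(\<Sum>i<2. A i j *\<^sub>R unit_vec i) \<in> euclid d" for j
  proof -
    have "euclid 2 \<subseteq> euclid d" using assms by (auto simp: euclid_def)
    then show ?thesis using column_in_euclid[where A = "\<lambda>i. A i j" and d = 2] by blast
  qed
  ultimately show thesis using that by blast
qed

section \<open>Random sign matrices\<close>

text \<open>\<open>T\<close> marks the plus signs of a row, so that averaging over random signs
  becomes a sum over \<open>Pow {..<m}\<close>.\<close>

definition sign_sum :: "nat \<Rightarrow> (nat \<Rightarrow> real) \<Rightarrow> nat set \<Rightarrow> real" where
  "sign_sum m z T = (\<Sum>j<m. (if j \<in> T then 1 else -1) * z j)"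

lemma sum_Pow_Suc:
  fixes F :: "nat set \<Rightarrow> real"
  shows "(\<Sum>T\<in>Pow {..<Suc m}. F T) = (\<Sum>T\<in>Pow {..<m}. F T + F (insert m T))"
proof -
  have inj: "inj_on (insert m) (Pow {..<m})"
    by (intro inj_onI) (metis PowD insert_ident lessThan_iff order_less_irrefl subsetD)
  have "Pow {..<Suc m} = Pow {..<m} \<union> insert m ` Pow {..<m}"
    by (simp add: lessThan_Suc Pow_insert)
  moreover have "Pow {..<m} \<inter> insert m ` Pow {..<m} = {}" by auto
  ultimately have "(\<Sum>T\<in>Pow {..<Suc m}. F T) = (\<Sum>T\<in>Pow {..<m}. F T) + (\<Sum>T\<in>insert m ` Pow {..<m}. F T)"
    by (simp add: sum.union_disjoint)
  also have "(\<Sum>T\<in>insert m ` Pow {..<m}. F T) = (\<Sum>T\<in>Pow {..<m}. F (insert m T))"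
    using inj by (simp add: sum.reindex)
  finally show ?thesis by (simp add: sum.distrib)
qed

lemma sign_sum_Suc:
  assumes "T \<subseteq> {..<m}"
  shows "sign_sum (Suc m) z T = sign_sum m z T - z m"
    "sign_sum (Suc m) z (insert m T) = sign_sum m z T + z m"
proof -
  have "m \<notin> T" using assms by auto
  then show "sign_sum (Suc m) z T = sign_sum m z T - z m" by (simp add: sign_sum_def)
  have "(\<Sum>j<m. (if j \<in> insert m T then 1 else -1) * z j) = (\<Sum>j<m. (if j \<in> T then 1 else -1) * z j)"
    by (intro sum.cong) auto
  then show "sign_sum (Suc m) z (insert m T) = sign_sum m z T + z m" by (simp add: sign_sum_def)
qed

lemma sign_sum_moment_2: "(\<Sum>T\<in>Pow {..<m}. (sign_sum m z T)\<^sup>2) = 2 ^ m * (\<Sum>j<m. (z j)\<^sup>2)"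
proof (induction m)
  case 0
  then show ?case by (simp add: sign_sum_def)
next
  case (Suc m)
  have "(\<Sum>T\<in>Pow {..<Suc m}. (sign_sum (Suc m) z T)\<^sup>2)
      = (\<Sum>T\<in>Pow {..<m}. 2 * (sign_sum m z T)\<^sup>2 + 2 * (z m)\<^sup>2)"
    unfolding sum_Pow_Suc
    by (intro sum.cong) (auto simp: sign_sum_Suc power2_eq_square algebra_simps)
  also have "\<dots> = 2 ^ Suc m * (\<Sum>j<Suc m. (z j)\<^sup>2)"
    using Suc by (simp add: sum.distrib card_Pow algebra_simps flip: sum_distrib_left)
  finally show ?case .
qed

lemma sign_sum_moment_4: "(\<Sum>T\<in>Pow {..<m}. (sign_sum m z T) ^ 4) \<le> 3 * 2 ^ m * (\<Sum>j<m. (z j)\<^sup>2)\<^sup>2"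
proof (induction m)
  case 0
  then show ?case by (simp add: sign_sum_def)
next
  case (Suc m)
  let ?s = "\<Sum>j<m. (z j)\<^sup>2"
  have "(\<Sum>T\<in>Pow {..<Suc m}. (sign_sum (Suc m) z T) ^ 4)
      = (\<Sum>T\<in>Pow {..<m}. 2 * (sign_sum m z T) ^ 4 + 12 * (z m)\<^sup>2 * (sign_sum m z T)\<^sup>2 + 2 * (z m) ^ 4)"
    unfolding sum_Pow_Suc
    by (intro sum.cong) (auto simp: sign_sum_Suc eval_nat_numeral algebra_simps)
  also have "\<dots> = 2 * (\<Sum>T\<in>Pow {..<m}. (sign_sum m z T) ^ 4) + 12 * (z m)\<^sup>2 * (2 ^ m * ?s) + 2 ^ m * (2 * (z m) ^ 4)"
    unfolding sign_sum_moment_2[symmetric] by (simp add: sum.distrib card_Pow sum_distrib_left)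
  \<comment> \<open>Raising the coefficient 2 of \<open>(z m) ^ 4\<close> to 6 completes the square;
    3 is the Gaussian constant.\<close>
  also have "\<dots> \<le> 2 * (3 * 2 ^ m * ?s\<^sup>2) + 12 * (z m)\<^sup>2 * (2 ^ m * ?s) + 2 ^ m * (6 * (z m) ^ 4)"
    using Suc by (intro add_mono mult_left_mono) auto
  also have "\<dots> = 3 * 2 ^ Suc m * (\<Sum>j<Suc m. (z j)\<^sup>2)\<^sup>2"
    by (simp add: power2_eq_square power4_eq_xxxx algebra_simps)
  finally show ?case .
qed

lemma exp_1_lower: "27182 / 10000 \<le> exp (1::real)"
  and exp_1_upper: "exp (1::real) \<le> 271829 / 100000"
  using e_approx_32 unfolding abs_le_iff by simp_all

text \<open>The coefficients put a local minimum of the quotient of both sides at \<open>t = 3/2\<close>, where the extremal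
  distribution with first two moments at most 1/2 and 3/4 has its second atom.\<close>

lemma exp_minus_le_quadratic:
  fixes t :: real
  assumes "0 \<le> t"
  shows "exp (- t) \<le> 1 - 8116/10000 * t + 196/1000 * t\<^sup>2"
proof -
  define F :: "real \<Rightarrow> real" where "F t = (1 - 8116/10000 * t + 196/1000 * t\<^sup>2) * exp t" for t
  \<comment> \<open>The zeros are 157/245, a local maximum of \<open>F\<close>, and 3/2, a local
    minimum; so only the values of \<open>F\<close> at 0 and 3/2 have to be compared with 1.\<close>
  define F' :: "real \<Rightarrow> real" where "F' t = exp t * (196/1000 * (t - 157/245) * (t - 3/2))" for t
  have F': "(F has_real_derivative F' x) (at x)" for x
    unfolding F_def F'_def
    by (rule derivative_eq_intros refl | simp add: power2_eq_square field_simps)+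
  have "1 \<le> F t"
  proof (cases "t \<le> 157/245")
    case True
    have "F 0 \<le> F t"
    proof (rule DERIV_nonneg_imp_nondecreasing[OF assms])
      fix x :: real assume "0 \<le> x" "x \<le> t"
      then have "0 \<le> F' x" unfolding F'_def using True
        by (intro mult_nonneg_nonneg mult_nonpos_nonpos) (auto simp: mult_nonneg_nonpos)
      then show "\<exists>y. (F has_real_derivative y) (at x) \<and> 0 \<le> y" using F' by blast
    qed
    then show ?thesis by (simp add: F_def)
  next
    case False
    have "F (3/2) \<le> F t"
    proof (cases "t \<le> 3/2")
      case True
      show ?thesis
      proof (rule DERIV_nonpos_imp_nonincreasing[OF True])
        fix x :: real assume "t \<le> x" "x \<le> 3/2"
        then have "F' x \<le> 0" unfolding F'_def using False
          by (intro mult_nonneg_nonpos) auto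
        then show "\<exists>y. (F has_real_derivative y) (at x) \<and> y \<le> 0" using F' by blast
      qed
    next
      case False
      show ?thesis
      proof (rule DERIV_nonneg_imp_nondecreasing[of "3/2" t F])
        show "3/2 \<le> t" using False by simp
        fix x :: real assume "3/2 \<le> x" "x \<le> t"
        then have "0 \<le> F' x" unfolding F'_def by (intro mult_nonneg_nonneg) auto
        then show "\<exists>y. (F has_real_derivative y) (at x) \<and> 0 \<le> y" using F' by blast
      qed
    qed
    moreover have "1 \<le> F (3/2)"
    proof -
      \<comment> \<open>The quadratic is 0.2236 at 3/2, and 4.4724 exceeds its reciprocal; squaring
        turns \<open>exp (3/2)\<close> into a power of \<open>exp 1\<close>.\<close>
      have "(44724/10000::real)\<^sup>2 \<le> (27182/10000) ^ 3" by (simp add: power2_eq_square power3_eq_cube)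
      also have "\<dots> \<le> exp 1 ^ 3" using exp_1_lower by (intro power_mono) auto
      also have "\<dots> = (exp (3/2))\<^sup>2" by (simp flip: exp_of_nat_mult)
      finally have "44724/10000 \<le> exp (3/2::real)" by (rule power2_le_imp_le) simp
      then show ?thesis by (simp add: F_def power2_eq_square)
    qed
    ultimately show ?thesis by simp
  qed
  then show ?thesis by (simp add: F_def exp_minus field_simps)
qed

text \<open>Markov's inequality for \<open>exp (1/6 - g\<^sup>2 / 2)\<close> at the threshold \<open>g\<^sup>2 \<le> 1/3\<close>; numerically 0.8757.\<close>

definition tail_base :: real where "tail_base = 7412/10000 * exp (1/6)"

text \<open>The variable \<open>(sign_sum m z T)\<^sup>2 / (2 * s)\<close>, with \<open>s\<close>
  the squared norm of \<open>z\<close>, has mean 1/2 and second moment at most 3/4, so the quadratic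
  bound averages to 1 - 0.4058 + 3 * 0.049 = 0.7412.\<close>

lemma sign_sum_laplace:
  assumes s: "0 < (\<Sum>j<m. (z j)\<^sup>2)"
  shows "(\<Sum>T\<in>Pow {..<m}. exp (1/6 - (sign_sum m z T)\<^sup>2 / (2 * (\<Sum>j<m. (z j)\<^sup>2)))) \<le> 2 ^ m * tail_base"
proof -
  let ?s = "\<Sum>j<m. (z j)\<^sup>2"
  let ?g = "sign_sum m z"
  have "(\<Sum>T\<in>Pow {..<m}. exp (- ((?g T)\<^sup>2 / (2 * ?s))))
      \<le> (\<Sum>T\<in>Pow {..<m}. 1 - 4058/10000 / ?s * (?g T)\<^sup>2 + 49/1000 / ?s\<^sup>2 * (?g T) ^ 4)"
  proof (rule sum_mono)
    fix T
    have "0 \<le> (?g T)\<^sup>2 / (2 * ?s)" using s by simp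
    from exp_minus_le_quadratic[OF this]
    show "exp (- ((?g T)\<^sup>2 / (2 * ?s))) \<le> 1 - 4058/10000 / ?s * (?g T)\<^sup>2 + 49/1000 / ?s\<^sup>2 * (?g T) ^ 4"
      by (simp add: power_divide power_mult_distrib flip: power_mult)
  qed
  also have "\<dots> = 2 ^ m - 4058/10000 / ?s * (\<Sum>T\<in>Pow {..<m}. (?g T)\<^sup>2)
      + 49/1000 / ?s\<^sup>2 * (\<Sum>T\<in>Pow {..<m}. (?g T) ^ 4)"
    by (simp add: sum.distrib sum_subtractf sum_distrib_left card_Pow)
  also have "\<dots> \<le> 2 ^ m - 4058/10000 / ?s * (2 ^ m * ?s) + 49/1000 / ?s\<^sup>2 * (3 * 2 ^ m * ?s\<^sup>2)"
    using sign_sum_moment_4[of m z] s unfolding sign_sum_moment_2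
    by (intro add_mono mult_left_mono) auto
  also have "\<dots> = 7412/10000 * 2 ^ m" using s by (simp add: field_simps)
  finally have le: "(\<Sum>T\<in>Pow {..<m}. exp (- ((?g T)\<^sup>2 / (2 * ?s)))) \<le> 7412/10000 * 2 ^ m" .
  have "exp (1/6 - x) = exp (1/6) * exp (- x)" for x :: real
    by (simp add: mult_exp_exp)
  then have "(\<Sum>T\<in>Pow {..<m}. exp (1/6 - (?g T)\<^sup>2 / (2 * ?s)))
      = exp (1/6) * (\<Sum>T\<in>Pow {..<m}. exp (- ((?g T)\<^sup>2 / (2 * ?s))))"
    by (simp only: sum_distrib_left)
  also have "\<dots> \<le> exp (1/6) * (7412/10000 * 2 ^ m)"
    using le by (intro mult_left_mono) auto
  also have "\<dots> = 2 ^ m * tail_base" by (simp add: tail_base_def)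
  finally show ?thesis .
qed

text \<open>Each row is given by its set of plus signs; the extensional product is finite and lets
  sums over matrices factor into rows.\<close>

definition sign_matrices :: "nat \<Rightarrow> nat \<Rightarrow> (nat \<Rightarrow> nat set) set" where
  "sign_matrices d m = PiE {..<d} (\<lambda>_. Pow {..<m})"

lemma finite_sign_matrices: "finite (sign_matrices d m)"
  unfolding sign_matrices_def by (intro finite_PiE) auto

lemma card_sign_matrices: "card (sign_matrices d m) = (2 ^ m) ^ d"
  unfolding sign_matrices_def by (simp add: card_PiE card_Pow)

text \<open>Chernoff's method: for a bad matrix the exponents add up to at least 0, so its product
  of weights is at least 1. The sum of these products over all matrices factors over the
  rows.\<close>

lemma card_bad_matrices:
  assumes s: "0 < (\<Sum>j<m. (z j)\<^sup>2)"
  shows "card {A \<in> sign_matrices d m. 3 * (\<Sum>i<d. (sign_sum m z (A i))\<^sup>2) \<le> real d * (\<Sum>j<m. (z j)\<^sup>2)}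
    \<le> (2 ^ m * tail_base) ^ d"
proof -
  let ?s = "\<Sum>j<m. (z j)\<^sup>2"
  let ?g = "sign_sum m z"
  let ?w = "\<lambda>T. exp (1/6 - (?g T)\<^sup>2 / (2 * ?s))"
  let ?Bad = "{A \<in> sign_matrices d m. 3 * (\<Sum>i<d. (?g (A i))\<^sup>2) \<le> d * ?s}"
  have "real (card ?Bad) = (\<Sum>A\<in>?Bad. 1)" by simp
  also have "\<dots> \<le> (\<Sum>A\<in>?Bad. \<Prod>i<d. ?w (A i))"
  proof (rule sum_mono)
    fix A assume "A \<in> ?Bad"
    then have "(\<Sum>i<d. (?g (A i))\<^sup>2) / (2 * ?s) \<le> d / 6" using s by (simp add: field_simps)
    then have "1 \<le> exp (\<Sum>i<d. 1/6 - (?g (A i))\<^sup>2 / (2 * ?s))"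
      by (simp add: sum_subtractf sum_divide_distrib)
    then show "1 \<le> (\<Prod>i<d. ?w (A i))" by (simp add: exp_sum)
  qed
  also have "\<dots> \<le> (\<Sum>A\<in>sign_matrices d m. \<Prod>i<d. ?w (A i))"
    using finite_sign_matrices by (intro sum_mono2) (auto intro!: prod_nonneg)
  also have "\<dots> = (\<Prod>i<d. \<Sum>T\<in>Pow {..<m}. ?w T)"
    unfolding sign_matrices_def by (rule prod_sum_PiE[symmetric]) auto
  also have "\<dots> \<le> (2 ^ m * tail_base) ^ d"
    using sign_sum_laplace[OF s] by (simp add: power_mono sum_nonneg)
  finally show ?thesis .
qed

section \<open>Sampling kernel vectors by lattice points\<close>

lemma weighted_average_bound:
  fixes p f :: "nat \<Rightarrow> real"
  assumes "\<And>i. i < m \<Longrightarrow> 0 \<le> p i" "(\<Sum>i<m. p i) = 1" "(\<Sum>i<m. p i * f i) \<le> c"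
  shows "\<exists>i<m. f i \<le> c"
proof (rule ccontr)
  assume "\<not> ?thesis"
  then have f: "c < f i" if "i < m" for i using that by auto
  have ex: "\<exists>i<m. 0 < p i"
  proof (rule ccontr)
    assume "\<not> ?thesis"
    then have "p i \<le> 0" if "i < m" for i using that by (meson not_less)
    then have "(\<Sum>i<m. p i) \<le> 0" by (intro sum_nonpos) auto
    then show False using assms(2) by simp
  qed
  have "(\<Sum>i<m. p i * c) < (\<Sum>i<m. p i * f i)"
  proof (rule sum_strict_mono_ex1)
    show "\<forall>i\<in>{..<m}. p i * c \<le> p i * f i"
      using assms(1) f by (auto intro!: mult_left_mono intro: less_imp_le)
    show "\<exists>i\<in>{..<m}. p i * c < p i * f i"
      using ex f by (auto intro!: mult_strict_left_mono)
  qed simp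
  also have "(\<Sum>i<m. p i * c) = c" using assms(2) by (simp flip: sum_distrib_right)
  finally show False using assms(3) by simp
qed

text \<open>Maurey's empirical method, derandomised: the right-hand side is the expectation of \<open>B\<close> at \<open>z\<close> plus \<open>N\<close>
  independent vectors \<open>u i\<close>, drawn with probabilities \<open>p i\<close> and mean \<open>h\<close>.\<close>

lemma empirical_method:
  fixes B :: "(nat \<Rightarrow> real) \<Rightarrow> (nat \<Rightarrow> real) \<Rightarrow> real" and p :: "nat \<Rightarrow> real"
  assumes sym: "\<And>x y. B x y = B y x"
    and add: "\<And>x y w. B (\<lambda>j. x j + y j) w = B x w + B y w"
    and p: "\<And>i. i < m \<Longrightarrow> 0 \<le> p i" "(\<Sum>i<m. p i) = 1"
    and mean: "\<And>w. (\<Sum>i<m. p i * B (u i) w) = B h w"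
    and step: "\<And>n z i. z \<in> Z n \<Longrightarrow> i < m \<Longrightarrow> (\<lambda>j. z j + u i j) \<in> Z (Suc n)"
    and z: "z \<in> Z n"
  shows "\<exists>y\<in>Z (n + N). B y y \<le> B z z + 2 * real N * B z h
           + real N * (\<Sum>i<m. p i * B (u i) (u i)) + real N * (real N - 1) * B h h"
  using z
proof (induction N arbitrary: z n)
  case 0
  then show ?case by auto
next
  case (Suc N)
  define G where "G = (\<Sum>i<m. p i * B (u i) (u i))"
  define K where "K = B z z + 2 * real N * B z h + real N * G + real N * (real N - 1) * B h h"
  let ?w = "\<lambda>i j. z j + u i j"
  \<comment> \<open>\<open>?f i\<close> is what the induction hypothesis promises after a first draw
    \<open>u i\<close>. Its mean over \<open>p\<close> is the bound for \<open>Suc N\<close>, so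
    some draw stays within that bound.\<close>
  let ?f = "\<lambda>i. B (?w i) (?w i) + 2 * real N * B (?w i) h + real N * G + real N * (real N - 1) * B h h"
  let ?c = "B z z + 2 * real (Suc N) * B z h + real (Suc N) * G + real (Suc N) * (real (Suc N) - 1) * B h h"
  have f: "p i * ?f i = p i * K + 2 * (p i * B (u i) z) + p i * B (u i) (u i) + 2 * real N * (p i * B (u i) h)" for i
  proof -
    have "B (?w i) (?w i) = B z z + 2 * B (u i) z + B (u i) (u i)"
      using add sym[of _ "?w i"] sym[of z "u i"] by simp
    moreover have "B (?w i) h = B z h + B (u i) h" by (rule add)
    ultimately show ?thesis by (simp add: K_def algebra_simps)
  qed
  have "(\<Sum>i<m. p i * ?f i) = K + 2 * B h z + G + 2 * real N * B h h"
    unfolding f unfolding sum.distrib sum_distrib_left[symmetric] sum_distrib_right[symmetric] p(2) mean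
    by (simp add: G_def)
  also have "\<dots> = ?c"
    unfolding K_def sym[of h z] by (simp add: algebra_simps)
  finally obtain i where i: "i < m" "?f i \<le> ?c"
    using weighted_average_bound[of m p ?f ?c] p by auto
  obtain y where "y \<in> Z (Suc n + N)" "B y y \<le> ?f i"
    using Suc.IH[OF step[OF Suc.prems i(1)]] unfolding G_def by blast
  with i(2) show ?case unfolding G_def by (intro bexI[of _ y]) auto
qed

text \<open>The first \<open>m\<close> list entries count draws of positive unit vectors, the last
  \<open>m\<close> those of negative ones. Opposite draws may cancel, so the \<open>l1\<close> norm
  can be below \<open>N\<close>; counting lists still bounds the number of points.\<close>

definition lattice_points :: "nat \<Rightarrow> nat \<Rightarrow> (nat \<Rightarrow> real) set" where
  "lattice_points m N = (\<lambda>l j. if j < m then real (l ! j) - real (l ! (m + j)) else 0) `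
     {l :: nat list. length l = 2 * m \<and> sum_list l = N}"

lemma finite_nat_lists: "finite {l :: nat list. length l = k \<and> sum_list l = N}"
proof (rule finite_subset)
  show "{l. length l = k \<and> sum_list l = N} \<subseteq> {l. set l \<subseteq> {..N} \<and> length l = k}"
    using member_le_sum_list by fastforce
  show "finite {l. set l \<subseteq> {..N} \<and> length l = k}"
    by (rule finite_lists_length_eq) simp
qed

lemma finite_lattice_points: "finite (lattice_points m N)"
  unfolding lattice_points_def by (intro finite_imageI finite_nat_lists)

lemma card_lattice_points: "card (lattice_points m N) \<le> (N + 2 * m - 1) choose N"
  unfolding lattice_points_def
  using card_image_le[OF finite_nat_lists, of _ "2 * m" N] by (simp add: card_length_sum_list)

lemma zero_lattice_point: "(\<lambda>_. 0) \<in> lattice_points m 0"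
  unfolding lattice_points_def
  by (intro image_eqI[of _ _ "replicate (2 * m) 0"]) (auto simp: sum_list_replicate)

lemma lattice_point_step:
  assumes z: "z \<in> lattice_points m n" and i: "i < m" and e: "\<bar>e\<bar> = 1"
  shows "(\<lambda>j. z j + (if j = i then e else 0)) \<in> lattice_points m (Suc n)"
proof -
  obtain l :: "nat list" where l: "length l = 2 * m" "sum_list l = n"
    "z = (\<lambda>j. if j < m then real (l ! j) - real (l ! (m + j)) else 0)"
    using z unfolding lattice_points_def by auto
  define r where "r = (if e = 1 then i else m + i)"
  have r: "r < length l" using i l(1) by (auto simp: r_def)
  have e': "e = 1 \<or> e = -1" using e by linarith
  have "l ! r \<le> n" using member_le_sum_list[of "l ! r" l] r l(2) by simp
  then have "sum_list (l[r := Suc (l ! r)]) = Suc n"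
    using r l(2) by (simp add: sum_list_update)
  moreover have "(\<lambda>j. z j + (if j = i then e else 0))
      = (\<lambda>j. if j < m then real (l[r := Suc (l ! r)] ! j) - real (l[r := Suc (l ! r)] ! (m + j)) else 0)"
    using e' i l(1) by (auto simp: fun_eq_iff l(3) r_def nth_list_update)
  ultimately show ?thesis
    unfolding lattice_points_def using l(1) by (intro image_eqI[of _ _ "l[r := Suc (l ! r)]"]) auto
qed

text \<open>At 0 the positive and negative counts would agree and their total would be even. This is
  the purpose of the 1 in \<open>8 * k + 1\<close>.\<close>

lemma odd_lattice_point_nonzero:
  assumes z: "z \<in> lattice_points m N" and N: "odd N"
  shows "0 < (\<Sum>j<m. (z j)\<^sup>2)"
proof (rule ccontr)
  assume "\<not> ?thesis"
  then have "(\<Sum>j<m. (z j)\<^sup>2) = 0"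
    using sum_nonneg[of "{..<m}" "\<lambda>j. (z j)\<^sup>2"] by fastforce
  then have z0: "z j = 0" if "j < m" for j
    using that by (subst (asm) sum_nonneg_eq_0_iff) auto
  obtain l :: "nat list" where l: "length l = 2 * m" "sum_list l = N"
    "z = (\<lambda>j. if j < m then real (l ! j) - real (l ! (m + j)) else 0)"
    using z unfolding lattice_points_def by auto
  have split: "(\<Sum>j<m + n. l ! j) = (\<Sum>j<m. l ! j) + (\<Sum>j<n. l ! (m + j))" for n
    by (induction n) (simp_all add: add.assoc)
  have "N = (\<Sum>j<m + m. l ! j)"
    using l(1,2) by (simp add: sum_list_sum_nth atLeast0LessThan mult_2)
  also have "\<dots> = (\<Sum>j<m. l ! j) + (\<Sum>j<m. l ! (m + j))"
    by (rule split)
  also have "(\<Sum>j<m. l ! (m + j)) = (\<Sum>j<m. l ! j)"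
    using z0 by (intro sum.cong) (auto simp: l(3))
  finally show False using N by simp
qed

text \<open>Union bound: each lattice point is bad for at most a fraction
  \<open>tail_base ^ d\<close> of the matrices, and stars and bars bounds the number of
  points.\<close>

lemma good_matrix_exists:
  assumes "real ((2 * m + 8 * k) choose (8 * k + 1)) * tail_base ^ d < 1"
  obtains A where "\<And>z. z \<in> lattice_points m (8 * k + 1) \<Longrightarrow>
    real d * (\<Sum>j<m. (z j)\<^sup>2) < 3 * (\<Sum>i<d. (sign_sum m z (A i))\<^sup>2)"
proof -
  let ?Z = "lattice_points m (8 * k + 1)"
  let ?bad = "\<lambda>z :: nat \<Rightarrow> real. {A \<in> sign_matrices d m. 3 * (\<Sum>i<d. (sign_sum m z (A i))\<^sup>2) \<le> real d * (\<Sum>j<m. (z j)\<^sup>2)}"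
  have tb: "0 < tail_base" by (simp add: tail_base_def)
  have "real (card (\<Union>z\<in>?Z. ?bad z)) \<le> (\<Sum>z\<in>?Z. real (card (?bad z)))"
    using of_nat_mono[OF card_UN_le[OF finite_lattice_points[of m "8 * k + 1"], of ?bad], where 'a = real]
    by (simp only: of_nat_sum)
  also have "\<dots> \<le> (\<Sum>z\<in>?Z. (2 ^ m * tail_base) ^ d)"
    by (intro sum_mono card_bad_matrices odd_lattice_point_nonzero) auto
  also have "\<dots> = real (card ?Z) * tail_base ^ d * (2 ^ m) ^ d"
    by (simp add: power_mult_distrib)
  also have "\<dots> \<le> real ((2 * m + 8 * k) choose (8 * k + 1)) * tail_base ^ d * (2 ^ m) ^ d"
    using card_lattice_points[of m "8 * k + 1"] tb by (intro mult_right_mono) (auto simp: add.commute)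
  also have "\<dots> < 1 * (2 ^ m) ^ d"
    using assms by (intro mult_strict_right_mono) auto
  finally have "real (card (\<Union>z\<in>?Z. ?bad z)) < real ((2 ^ m) ^ d)" by simp
  then have "card (\<Union>z\<in>?Z. ?bad z) < card (sign_matrices d m)"
    by (simp only: card_sign_matrices of_nat_less_iff)
  moreover have "finite (\<Union>z\<in>?Z. ?bad z)"
    by (intro finite_UN_I finite_lattice_points) (auto intro: finite_subset[OF _ finite_sign_matrices])
  ultimately have "\<not> sign_matrices d m \<subseteq> (\<Union>z\<in>?Z. ?bad z)"
    by (meson card_mono not_less)
  then obtain A where "A \<in> sign_matrices d m" "A \<notin> (\<Union>z\<in>?Z. ?bad z)" by blast
  then show thesis by (intro that[of A]) (force simp: not_le)
qed

text \<open>A violating kernel vector lets the empirical method find a lattice point where the form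
  \<open>B\<close> is nonpositive, whereas \<open>good\<close> makes it positive at all of
  them.\<close>

lemma nsp_of_good_matrix:
  fixes A :: "nat \<Rightarrow> nat set"
  assumes good: "\<And>z. z \<in> lattice_points m (8 * k + 1) \<Longrightarrow>
      real d * (\<Sum>j<m. (z j)\<^sup>2) < 3 * (\<Sum>i<d. (sign_sum m z (A i))\<^sup>2)"
  shows "nsp k m (\<lambda>j. \<Sum>i<d. (if j \<in> A i then 1 else -1) *\<^sub>R unit_vec i)"
proof (rule nsp_columns, rule ccontr)
  fix h :: "nat \<Rightarrow> real" and S
  assume ker: "\<And>i. i < d \<Longrightarrow> (\<Sum>j<m. h j * (if j \<in> A i then 1 else -1)) = 0"
    and h: "\<exists>j<m. h j \<noteq> 0" and S: "S \<subseteq> {..<m}" "card S \<le> k"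
    and neg: "\<not> 2 * (\<Sum>j\<in>S. \<bar>h j\<bar>) < (\<Sum>j<m. \<bar>h j\<bar>)"
  define t where "t = (\<Sum>j<m. \<bar>h j\<bar>)"
  have t: "0 < t" unfolding t_def using h by (auto intro!: sum_pos2)
  define g where "g j = h j / t" for j
  define p where "p j = \<bar>g j\<bar>" for j
  define e where "e j = (if g j < 0 then -1 else 1 :: real)" for j
  define u where "u i = (\<lambda>j. if j = i then e i else 0)" for i :: nat
  define B where "B x y = (\<Sum>i<d. sign_sum m x (A i) * sign_sum m y (A i)) - d / 3 * (\<Sum>j<m. x j * y j)" for x y
  have pe: "p j * e j = g j" for j by (auto simp: p_def e_def)
  have p1: "(\<Sum>j<m. p j) = 1" using t by (simp add: p_def g_def t_def flip: sum_divide_distrib)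
  have su: "sign_sum m (u i) T = (if i \<in> T then 1 else -1) * e i" if "i < m" for i T
  proof -
    have "sign_sum m (u i) T = (\<Sum>j<m. if j = i then (if i \<in> T then 1 else -1) * e i else 0)"
      unfolding sign_sum_def u_def by (intro sum.cong) auto
    then show ?thesis using that by simp
  qed
  have sum_u: "(\<Sum>j<m. u i j * y j) = e i * y i" if "i < m" for i y
  proof -
    have "(\<Sum>j<m. u i j * y j) = (\<Sum>j<m. if j = i then e i * y i else 0)"
      unfolding u_def by (intro sum.cong) auto
    then show ?thesis using that by simp
  qed
  have sg: "sign_sum m g (A i) = 0" if "i < d" for i
  proof -
    have "sign_sum m g (A i) = (\<Sum>j<m. h j * (if j \<in> A i then 1 else -1)) / t"
      unfolding sign_sum_def g_def by (simp add: sum_divide_distrib mult.commute)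
    then show ?thesis using ker[OF that] by simp
  qed
  have sym: "B x y = B y x" for x y by (simp add: B_def mult.commute)
  have add: "B (\<lambda>j. x j + y j) w = B x w + B y w" for x y w
    by (simp add: B_def sign_sum_def distrib_left distrib_right sum.distrib)
  have mean: "(\<Sum>i<m. p i * B (u i) w) = B g w" for w
  proof -
    have "(\<Sum>i<m. p i * B (u i) w)
        = (\<Sum>i<m. \<Sum>l<d. (if i \<in> A l then 1 else -1) * g i * sign_sum m w (A l)) - d / 3 * (\<Sum>i<m. g i * w i)"
      unfolding sum_distrib_left sum_subtractf[symmetric]
    proof (rule sum.cong)
      fix i assume "i \<in> {..<m}"
      then have i: "i < m" by simp
      have "p i * B (u i) w = (\<Sum>l<d. (if i \<in> A l then 1 else -1) * (p i * e i) * sign_sum m w (A l))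
          - d / 3 * ((p i * e i) * w i)"
        unfolding B_def sum_u[OF i] su[OF i] right_diff_distrib sum_distrib_left by (simp add: mult_ac)
      then show "p i * B (u i) w = (\<Sum>l<d. (if i \<in> A l then 1 else -1) * g i * sign_sum m w (A l))
          - d / 3 * (g i * w i)" unfolding pe .
    qed simp
    also have "(\<Sum>i<m. \<Sum>l<d. (if i \<in> A l then 1 else -1) * g i * sign_sum m w (A l))
        = (\<Sum>l<d. sign_sum m g (A l) * sign_sum m w (A l))"
      by (subst sum.swap) (simp add: sign_sum_def sum_distrib_right)
    finally show ?thesis by (simp add: B_def)
  qed
  have Buu: "B (u i) (u i) = 2 * d / 3" if "i < m" for i
  proof -
    have ee: "e i * e i = 1" by (simp add: e_def)
    have "sign_sum m (u i) T * sign_sum m (u i) T = 1" for T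
      using ee by (auto simp: su[OF that])
    moreover have "u i i = e i" by (simp add: u_def)
    ultimately show ?thesis using ee by (simp add: B_def sum_u[OF that])
  qed
  have Bgg: "B g g = - (d / 3 * (\<Sum>j<m. (g j)\<^sup>2))"
    using sg by (simp add: B_def power2_eq_square)
  \<comment> \<open>Cauchy-Schwarz on \<open>S\<close>: at most \<open>k\<close> coordinates carry
    half of the mass.\<close>
  have g2: "1 \<le> 4 * k * (\<Sum>j<m. (g j)\<^sup>2)"
  proof -
    have "1 / 2 \<le> (\<Sum>j\<in>S. \<bar>g j\<bar>)"
      using neg t by (simp add: g_def field_simps t_def[symmetric] flip: sum_divide_distrib)
    then have "(1/2)\<^sup>2 \<le> (\<Sum>j\<in>S. \<bar>g j\<bar>)\<^sup>2" by (intro power_mono) auto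
    also have "\<dots> \<le> card S * (\<Sum>j\<in>S. (g j)\<^sup>2)"
      using sum_squared_le_sum_of_squares[of "\<lambda>j. \<bar>g j\<bar>" S] by (simp add: mult.commute)
    also have "\<dots> \<le> k * (\<Sum>j<m. (g j)\<^sup>2)"
      using S by (intro mult_mono sum_mono2) (auto intro: sum_nonneg)
    finally show ?thesis by (simp add: power2_eq_square)
  qed
  let ?N = "8 * k + 1"
  have "\<exists>y\<in>lattice_points m (0 + ?N). B y y \<le> B (\<lambda>_. 0) (\<lambda>_. 0) + 2 * real ?N * B (\<lambda>_. 0) g
           + real ?N * (\<Sum>i<m. p i * B (u i) (u i)) + real ?N * (real ?N - 1) * B g g"
  proof (rule empirical_method[where B = B and p = p and u = u and Z = "lattice_points m", OF sym add _ p1 mean _ zero_lattice_point])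
    show "0 \<le> p i" for i by (simp add: p_def)
    fix n z i assume "z \<in> lattice_points m n" "i < m"
    then show "(\<lambda>j. z j + u i j) \<in> lattice_points m (Suc n)"
      unfolding u_def by (rule lattice_point_step) (simp add: e_def)
  qed
  then obtain y where y: "y \<in> lattice_points m ?N" "B y y \<le> B (\<lambda>_. 0) (\<lambda>_. 0) + 2 * real ?N * B (\<lambda>_. 0) g
           + real ?N * (\<Sum>i<m. p i * B (u i) (u i)) + real ?N * (real ?N - 1) * B g g" by auto
  have z0: "B (\<lambda>_. 0) w = 0" for w by (simp add: B_def sign_sum_def)
  have avg: "(\<Sum>i<m. p i * B (u i) (u i)) = 2 * d / 3"
  proof -
    have "(\<Sum>i<m. p i * B (u i) (u i)) = (\<Sum>i<m. p i * (2 * d / 3))"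
      by (intro sum.cong) (simp_all add: Buu)
    then show ?thesis using p1 by (simp only: sum_distrib_right[symmetric] mult_1_left)
  qed
  have "B y y \<le> real ?N * (2 * d / 3) + real ?N * (8 * k) * B g g"
    using y(2) unfolding z0 avg by simp
  also have "\<dots> = real ?N * (2 * d / 3) * (1 - 4 * k * (\<Sum>j<m. (g j)\<^sup>2))"
    unfolding Bgg by (simp add: field_simps)
  also have "\<dots> \<le> 0" using g2 by (intro mult_nonneg_nonpos) auto
  finally have "3 * (\<Sum>i<d. (sign_sum m y (A i))\<^sup>2) \<le> real d * (\<Sum>j<m. (y j)\<^sup>2)"
    by (simp add: B_def power2_eq_square)
  with good[OF y(1)] show False by simp
qed

lemma nsp_exists:
  assumes "real ((2 * m + 8 * k) choose (8 * k + 1)) * tail_base ^ d < 1"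
  obtains a :: "nat \<Rightarrow> rvec" where "nsp k m a" "\<And>j. a j \<in> euclid d"
proof (rule good_matrix_exists[OF assms])
  fix A
  assume good: "\<And>z. z \<in> lattice_points m (8 * k + 1) \<Longrightarrow>
      real d * (\<Sum>j<m. (z j)\<^sup>2) < 3 * (\<Sum>i<d. (sign_sum m z (A i))\<^sup>2)"
  then have "nsp k m (\<lambda>j. \<Sum>i<d. (if j \<in> A i then 1 else -1) *\<^sub>R unit_vec i)"
    by (rule nsp_of_good_matrix)
  then show thesis
    by (rule that) (rule column_in_euclid)
qed

section \<open>Numerical estimates and the lower bound\<close>

lemma choose_le_exp:
  fixes t :: real
  assumes "0 < t"
  shows "real (n choose r) \<le> exp (real n * t) / t ^ r"
proof (cases "r \<le> n")
  case True
  \<comment> \<open>A single term of the expansion of \<open>(t + 1) ^ n\<close>; \<open>t\<close>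
    stays free for optimisation.\<close>
  have "real (n choose r) * t ^ r \<le> (\<Sum>i\<le>n. real (n choose i) * t ^ i)"
    using True assms by (intro member_le_sum) auto
  also have "\<dots> = (t + 1) ^ n" by (simp add: binomial_ring)
  also have "\<dots> \<le> exp t ^ n" using assms exp_ge_add_one_self[of t] by (intro power_mono) (auto simp: add.commute)
  also have "\<dots> = exp (real n * t)" by (simp add: exp_of_nat_mult)
  finally show ?thesis using assms by (simp add: field_simps)
next
  case False
  then have zero: "n choose r = 0" by (intro binomial_eq_0) simp
  show ?thesis unfolding zero using assms by simp
qed

text \<open>\<open>GREATEST\<close> is meaningful here because \<open>neighborly\<close> contains
  \<open>2 * k \<le> card (vertices P)\<close>.\<close>

lemma le_max_neighborly:
  assumes "cs_polytope d P" "card (vertices P) = 2 * (n + d)" "neighborly k P"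
  shows "k \<le> max_neighborly d n"
  unfolding max_neighborly_def
proof (rule Greatest_le_nat)
  show "\<exists>P. cs_polytope d P \<and> card (vertices P) = 2 * (n + d) \<and> neighborly k P" using assms by blast
  show "\<And>k. \<exists>P. cs_polytope d P \<and> card (vertices P) = 2 * (n + d) \<and> neighborly k P \<Longrightarrow> k \<le> n + d"
    unfolding neighborly_def by fastforce
qed

lemma cs_1_neighborly_exists:
  assumes "2 \<le> d" "d \<le> m"
  obtains P where "cs_polytope d P" "card (vertices P) = 2 * m" "neighborly 1 P"
proof -
  obtain a :: "nat \<Rightarrow> rvec" where "nsp 1 m a" "\<And>j. a j \<in> euclid d"
    using nsp_1_exists[OF assms(1)] by blast
  then show thesis
    using cs_neighborly_exists[of 1 m a d] assms that by force
qed

lemma max_neighborly_attained: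
  assumes "2 \<le> d"
  obtains P where "cs_polytope d P" "card (vertices P) = 2 * (n + d)" "neighborly (max_neighborly d n) P"
proof -
  let ?Q = "\<lambda>k. \<exists>P. cs_polytope d P \<and> card (vertices P) = 2 * (n + d) \<and> neighborly k P"
  have "?Q 1" using cs_1_neighborly_exists[OF assms, of "n + d"] by (metis le_add2)
  then have "?Q (Greatest ?Q)"
  proof (rule GreatestI_nat)
    show "\<And>k. ?Q k \<Longrightarrow> k \<le> n + d" unfolding neighborly_def by fastforce
  qed
  then show thesis using that unfolding max_neighborly_def by blast
qed

lemma tail_base_pos: "0 < tail_base"
  by (simp add: tail_base_def)

text \<open>The base of the exponential in \<open>d / 50\<close> that remains in
  \<open>choose_tail_double\<close>. The exponent 28/3 is 1 + 50/6, and cubing makes it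
  integral.\<close>

lemma tail_base_power_50: "201 * exp 1 * tail_base ^ 50 \<le> 7137/10000"
proof -
  have "exp (28/3::real) ^ 3 = exp 1 ^ 28" by (simp flip: exp_of_nat_mult)
  also have "\<dots> \<le> (271829 / 100000) ^ 28" using exp_1_upper by (intro power_mono) auto
  also have "\<dots> \<le> 11310 ^ 3" by (simp add: power_divide)
  finally have e: "exp (28/3::real) \<le> 11310" by (rule power_le_imp_le_base[of _ 2, simplified]) simp
  have "tail_base ^ 50 = (7412/10000) ^ 50 * exp (1/6) ^ 50"
    by (simp only: tail_base_def power_mult_distrib)
  then have "201 * exp 1 * tail_base ^ 50 = 201 * (7412/10000) ^ 50 * (exp 1 * exp (1/6) ^ 50)"
    by (simp only: mult_ac)
  also have "exp 1 * exp (1/6::real) ^ 50 = exp (28/3)" by (simp flip: exp_of_nat_mult exp_add)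
  finally have "201 * exp 1 * tail_base ^ 50 = 201 * (7412/10000) ^ 50 * exp (28/3)" .
  also have "\<dots> \<le> 201 * (7412/10000) ^ 50 * 11310" using e by (intro mult_left_mono) auto
  also have "\<dots> \<le> 7137/10000" by (simp add: power_divide)
  finally show ?thesis .
qed

text \<open>Leaves \<open>choose_tail_general\<close> a factor \<open>exp (d / 10)\<close> for the
  lattice points; the 30th power makes 1/10 + 1/6 = 4/15 integral.\<close>

lemma tail_base_less: "tail_base < exp (- (1/10))"
proof -
  have "tail_base * exp (1/10) = 7412/10000 * exp (4/15)"
    by (simp add: tail_base_def mult_exp_exp)
  then have "(tail_base * exp (1/10)) ^ 30 = (7412/10000) ^ 30 * exp (4/15) ^ 30"
    by (simp only: power_mult_distrib)
  also have "exp (4/15) ^ 30 = exp (1::real) ^ 8" by (simp flip: exp_of_nat_mult)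
  also have "(7412/10000) ^ 30 * exp (1::real) ^ 8 \<le> (7412/10000) ^ 30 * (271829 / 100000) ^ 8"
    using exp_1_upper by (intro mult_left_mono power_mono) auto
  also have "\<dots> < 1 ^ 30" by (simp add: power_divide)
  finally have "tail_base * exp (1/10) < 1" by (rule power_less_imp_less_base) simp
  then show ?thesis by (simp add: exp_minus field_simps)
qed

text \<open>The estimate is tight at \<open>d = 800\<close>: the parameter \<open>t = 1/201\<close> in \<open>choose_le_exp\<close> is optimal there.\<close>

lemma choose_tail_double:
  assumes d: "800 \<le> d"
  shows "real ((2 * (2 * d) + 8 * (d div 400)) choose (8 * (d div 400) + 1)) * tail_base ^ d < 1"
proof -
  let ?k = "d div 400"
  \<comment> \<open>\<open>x\<close> bounds \<open>8 * ?k\<close>, and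
    \<open>201 * x = 4 * d + d / 50\<close> bounds the upper index, so \<open>t = 1/201\<close>
    keeps the exponential factor below \<open>exp x\<close>.\<close>
  define x where "x = real d / 50"
  have x: "16 \<le> x" using d by (simp add: x_def)
  have "400 * ?k \<le> d" by simp
  then have "400 * real ?k \<le> real d" by linarith
  then have k: "8 * real ?k \<le> x" by (simp add: x_def)
  define Y where "Y = 201 * exp 1 * tail_base ^ 50"
  have Y: "0 < Y" "Y \<le> 7137/10000" using tail_base_power_50 tail_base_pos by (simp_all add: Y_def)
  have "real ((2 * (2 * d) + 8 * ?k) choose (8 * ?k + 1))
      \<le> exp (real (2 * (2 * d) + 8 * ?k) * (1/201)) / (1/201) ^ (8 * ?k + 1)"
    by (rule choose_le_exp) simp
  also have "\<dots> = exp (real (2 * (2 * d) + 8 * ?k) * (1/201)) * (201 * 201 powr (8 * real ?k))"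
    using powr_realpow[of 201 "8 * ?k"] by (simp add: power_divide)
  also have "\<dots> \<le> exp x * (201 * 201 powr x)"
    using k by (intro mult_mono powr_mono) (auto simp: x_def)
  finally have "real ((2 * (2 * d) + 8 * ?k) choose (8 * ?k + 1)) * tail_base ^ d
      \<le> exp x * (201 * 201 powr x) * tail_base ^ d"
    using tail_base_pos by (intro mult_right_mono) auto
  also have "\<dots> = 201 * Y powr x"
  proof -
    have "tail_base ^ d = tail_base powr (real 50 * x)"
      using powr_realpow[OF tail_base_pos, of d] by (simp add: x_def)
    also have "\<dots> = (tail_base powr real 50) powr x" by (simp only: powr_powr)
    also have "\<dots> = (tail_base ^ 50) powr x" by (simp only: powr_realpow[OF tail_base_pos])
    finally show ?thesis using tail_base_pos by (simp add: Y_def powr_mult exp_powr_real)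
  qed
  \<comment> \<open>As \<open>Y < 1\<close>, the smallest \<open>x\<close>, from
    \<open>d = 800\<close>, is the worst case.\<close>
  also have "\<dots> \<le> 201 * Y powr 16"
    using x Y by (intro mult_left_mono powr_mono') auto
  also have "\<dots> = 201 * Y ^ 16" using Y by simp
  also have "\<dots> \<le> 201 * (7137/10000) ^ 16" using Y by (intro mult_left_mono power_mono) auto
  also have "\<dots> < 1" by (simp add: power_divide)
  finally show ?thesis .
qed

lemma highly_neighborly_4d:
  assumes "2 \<le> d"
  shows "\<exists>P. cs_polytope d P \<and> card (vertices P) = 4 * d \<and> at_least_neighborly (real d / 400) P"
proof (cases "800 \<le> d")
  case True
  let ?k = "d div 400"
  obtain a :: "nat \<Rightarrow> rvec" where a: "nsp ?k (2 * d) a" "\<And>j. a j \<in> euclid d"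
    using nsp_exists[OF choose_tail_double[OF True]] by blast
  have "0 < d" "d \<le> 2 * d" "1 \<le> ?k" "?k \<le> 2 * d" using True by linarith+
  from cs_neighborly_exists[OF a(1) a(2) this] obtain P
    where P: "cs_polytope d P" "card (vertices P) = 2 * (2 * d)"
    "\<And>k'. 1 \<le> k' \<Longrightarrow> k' \<le> ?k \<Longrightarrow> neighborly k' P"
    by metis
  have "at_least_neighborly (real d / 400) P"
    unfolding at_least_neighborly_def
  proof (intro allI impI)
    fix k assume k: "1 \<le> k \<and> real k \<le> real d / 400"
    then have "400 * k \<le> d" by linarith
    then have "k \<le> ?k" by linarith
    then show "neighborly k P" using P(3) k by blast
  qed
  with P show ?thesis by auto
next
  case False
  \<comment> \<open>Here \<open>d / 400 < 2\<close>, so only \<open>k = 1\<close> is asked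
    for.\<close>
  obtain P where P: "cs_polytope d P" "card (vertices P) = 2 * (2 * d)" "neighborly 1 P"
    using cs_1_neighborly_exists[OF assms, of "2 * d"] by auto
  have "at_least_neighborly (real d / 400) P"
    unfolding at_least_neighborly_def
  proof (intro allI impI)
    fix k assume k: "1 \<le> k \<and> real k \<le> real d / 400"
    then have "400 * k \<le> d" by linarith
    then have "k = 1" using k False by linarith
    then show "neighborly k P" using P(3) by simp
  qed
  with P show ?thesis by auto
qed

text \<open>900 splits into 9, as \<open>8 * k + 1 \<le> 9 * k\<close>, and 100. The lower index is
  at most \<open>y = d / (100 * x)\<close>; \<open>t = y / (3 * m)\<close> gives a factor at most
  \<open>exp y\<close> and \<open>ln (1 / t) \<le> 9 + 2 * (x - 1)\<close>. The total exponent is at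
  most \<open>10 * x * y = d / 10\<close>.\<close>

lemma choose_tail_general:
  fixes d m k :: nat
  assumes d: "0 < d" "d \<le> m" and k: "1 \<le> k" "k \<le> real d / (900 * (1 + ln (real m / real d)))"
  shows "real ((2 * m + 8 * k) choose (8 * k + 1)) * tail_base ^ d < 1"
proof -
  define x where "x = 1 + ln (real m / real d)"
  define y where "y = real d / (100 * x)"
  have x: "1 \<le> x" using d by (simp add: x_def)
  have y: "0 < y" "y \<le> d / 100" using d x by (simp_all add: y_def field_simps)
  have "9 * real k \<le> y" using k x by (simp add: y_def x_def field_simps)
  then have Ny: "real (8 * k + 1) \<le> y" using k(1) by simp
  define t where "t = y / (3 * real m)"
  have m: "0 < real m" using d by simp
  have t: "0 < t" "t \<le> 1" using y d m by (simp_all add: t_def field_simps)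
  have lnt: "ln (1 / t) = ln 300 + (x - 1) + ln x"
  proof -
    define q where "q = real m / real d"
    have q: "0 < q" using d by (simp add: q_def)
    have "1 / t = 300 * q * x" using d x by (simp add: t_def y_def q_def field_simps)
    then have "ln (1 / t) = ln 300 + ln q + ln x" using q x by (simp add: ln_mult)
    then show ?thesis by (simp add: x_def q_def)
  qed
  have l300: "ln (300::real) \<le> 9"
  proof -
    have "(300::real) \<le> 2 ^ 9" by simp
    also have "\<dots> \<le> exp 1 ^ 9" using exp_1_lower by (intro power_mono) auto
    finally have "(300::real) \<le> exp 9" by (simp flip: exp_of_nat_mult)
    then show ?thesis using ln_le_cancel_iff[of 300 "exp 9"] by simp
  qed
  have "real ((2 * m + 8 * k) choose (8 * k + 1)) \<le> exp (real (2 * m + 8 * k) * t) / t ^ (8 * k + 1)"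
    using t by (intro choose_le_exp)
  also have "\<dots> = exp (real (2 * m + 8 * k) * t) * (1 / t) powr real (8 * k + 1)"
  proof -
    have "(1 / t) powr real (8 * k + 1) = (1 / t) ^ (8 * k + 1)" using t by (intro powr_realpow) auto
    then show ?thesis by (simp only: power_one_over times_divide_eq_right mult_1_right)
  qed
  also have "\<dots> \<le> exp y * (1 / t) powr y"
  proof (intro mult_mono powr_mono)
    have "real (2 * m + 8 * k) \<le> 3 * real m" using Ny y d by simp
    then have "real (2 * m + 8 * k) * t \<le> 3 * real m * t" using t by (intro mult_right_mono) auto
    then show "exp (real (2 * m + 8 * k) * t) \<le> exp y" using m by (simp add: t_def)
  qed (use Ny t in auto)
  also have "\<dots> = exp (y * (1 + ln 300 + (x - 1) + ln x))"
  proof -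
    have "exp y * (1 / t) powr y = exp (y * (1 + ln (1 / t)))"
      using t by (simp add: powr_def distrib_left exp_add)
    then show ?thesis by (simp only: lnt add.assoc)
  qed
  also have "\<dots> \<le> exp (y * (10 * x))"
  proof -
    have "ln x \<le> x - 1" using x by (intro ln_le_minus_one) auto
    then have "1 + ln 300 + (x - 1) + ln x \<le> 10 * x" using x l300 by linarith
    then show ?thesis using y by (simp add: mult_left_mono)
  qed
  also have "y * (10 * x) = d / 10" using x by (simp add: y_def)
  finally have "real ((2 * m + 8 * k) choose (8 * k + 1)) * tail_base ^ d \<le> exp (d / 10) * tail_base ^ d"
    using tail_base_pos by (intro mult_right_mono) auto
  also have "\<dots> < exp (d / 10) * exp (- (1/10)) ^ d"
    using tail_base_less tail_base_pos d by (intro mult_strict_left_mono power_strict_mono) auto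
  also have "\<dots> = 1" by (simp flip: exp_of_nat_mult exp_add)
  finally show ?thesis .
qed

lemma max_neighborly_lower:
  assumes d: "2 \<le> d"
  shows "1 / 1800 * real d / (1 + ln (real (n + d) / real d)) \<le> real (max_neighborly d n)"
proof -
  let ?m = "n + d"
  define r where "r = 1 / 1800 * real d / (1 + ln (real ?m / real d))"
  have x: "1 \<le> 1 + ln (real ?m / real d)" using d by simp
  show ?thesis
  proof (cases "r \<le> 1")
    case True
    obtain P where "cs_polytope d P" "card (vertices P) = 2 * ?m" "neighborly 1 P"
      using cs_1_neighborly_exists[OF d, of ?m] by auto
    then have "1 \<le> max_neighborly d n" by (rule le_max_neighborly)
    then show ?thesis using True unfolding r_def[symmetric] by linarith
  next
    case False
    \<comment> \<open>Rounding up at most doubles \<open>r > 1\<close>, hence 1800 = 2 *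
      900.\<close>
    define k where "k = nat \<lceil>r\<rceil>"
    have k: "r \<le> k" "real k \<le> 2 * r" "1 \<le> k" using False by (auto simp: k_def) linarith+
    have "real k \<le> real d / (900 * (1 + ln (real ?m / real d)))"
    proof -
      have "2 * r = real d / (900 * (1 + ln (real ?m / real d)))" using x by (simp add: r_def field_simps)
      then show ?thesis using k(2) by simp
    qed
    note kb = this
    have "r \<le> 1 / 1800 * real d / 1" unfolding r_def using x by (intro divide_left_mono) auto
    then have "k \<le> ?m" using k(2) by linarith
    have dm: "0 < d" "d \<le> ?m" using d by auto
    obtain a :: "nat \<Rightarrow> rvec" where a: "nsp k ?m a" "\<And>j. a j \<in> euclid d"
      using nsp_exists[OF choose_tail_general[OF dm k(3) kb]] by auto
    obtain P where "cs_polytope d P" "card (vertices P) = 2 * ?m" "neighborly k P"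
      using cs_neighborly_exists[OF a(1) a(2) dm k(3) \<open>k \<le> ?m\<close>] k(3) by (metis order_refl)
    then have "k \<le> max_neighborly d n" by (rule le_max_neighborly)
    then show ?thesis using k(1) unfolding r_def[symmetric] by linarith
  qed
qed

section \<open>Packing in the unit ball of a polytope\<close>

text \<open>For \<open>c \<ge> 0\<close> and a symmetric convex \<open>P\<close> containing 0: the
  norm with unit ball \<open>P\<close> is at most \<open>c\<close>, without an infimum.\<close>

definition in_scaled :: "'a::real_vector set \<Rightarrow> real \<Rightarrow> 'a \<Rightarrow> bool" where
  "in_scaled P c x \<longleftrightarrow> (\<exists>q\<in>P. x = c *\<^sub>R q)"

lemma in_scaled_mono:
  assumes "convex P" "0 \<in> P" "in_scaled P c x" "0 \<le> c" "c \<le> c'"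
  shows "in_scaled P c' x"
proof (cases "c' = 0")
  case True
  with assms show ?thesis by simp
next
  case False
  obtain q where q: "q \<in> P" "x = c *\<^sub>R q" using assms(3) unfolding in_scaled_def by blast
  have "(c / c') *\<^sub>R q + (1 - c / c') *\<^sub>R 0 \<in> P"
    using assms q False by (intro convexD) auto
  then have "(c / c') *\<^sub>R q \<in> P" by simp
  moreover have "x = c' *\<^sub>R ((c / c') *\<^sub>R q)" using q(2) False by simp
  ultimately show ?thesis unfolding in_scaled_def by blast
qed

lemma in_scaled_add:
  assumes "convex P" "in_scaled P a x" "in_scaled P b y" "0 \<le> a" "0 \<le> b"
  shows "in_scaled P (a + b) (x + y)"
proof -
  obtain q r where q: "q \<in> P" "x = a *\<^sub>R q" and r: "r \<in> P" "y = b *\<^sub>R r"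
    using assms(2,3) unfolding in_scaled_def by blast
  show ?thesis
  proof (cases "a + b = 0")
    case True
    then have "a = 0" "b = 0" using assms by auto
    then show ?thesis using q r unfolding in_scaled_def by auto
  next
    case False
    have "(a / (a + b)) *\<^sub>R q + (b / (a + b)) *\<^sub>R r \<in> P"
      using assms False q r by (intro convexD) (auto simp: divide_simps)
    moreover have "x + y = (a + b) *\<^sub>R ((a / (a + b)) *\<^sub>R q + (b / (a + b)) *\<^sub>R r)"
      using False by (simp add: q r scaleR_add_right)
    ultimately show ?thesis unfolding in_scaled_def by blast
  qed
qed

lemma in_scaled_scale:
  assumes "in_scaled P c x" shows "in_scaled P (t * c) (t *\<^sub>R x)"
  using assms unfolding in_scaled_def by auto

lemma in_scaled_minus:
  assumes "\<forall>q\<in>P. - q \<in> P" "in_scaled P c x"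
  shows "in_scaled P c (- x)"
  using assms unfolding in_scaled_def by (metis scaleR_minus_right)

text \<open>Triangle inequality; it converts small coordinate differences inside a grid cell into
  small distance in the norm of \<open>P\<close>.\<close>

lemma in_scaled_combination:
  fixes \<epsilon> :: real
  assumes P: "convex P" "0 \<in> P" "\<forall>q\<in>P. - q \<in> P" and "finite B" "B \<subseteq> P"
    and "\<And>b. b \<in> B \<Longrightarrow> \<bar>f b\<bar> \<le> \<epsilon>"
  shows "in_scaled P (card B * \<epsilon>) (\<Sum>b\<in>B. f b *\<^sub>R b)"
  using assms(4-)
proof (induction B)
  case empty
  then show ?case using P(2) by (auto simp: in_scaled_def)
next
  case (insert b B)
  have \<epsilon>: "0 \<le> \<epsilon>" using insert.prems(2)[of b] by simp
  have "in_scaled P \<bar>f b\<bar> (f b *\<^sub>R b)"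
  proof (cases "0 \<le> f b")
    case True
    then show ?thesis using insert.prems(1) unfolding in_scaled_def by auto
  next
    case False
    then have "f b *\<^sub>R b = \<bar>f b\<bar> *\<^sub>R (- b)" by simp
    then show ?thesis using insert.prems(1) P(3) unfolding in_scaled_def
      by (intro bexI[of _ "- b"]) auto
  qed
  from in_scaled_mono[OF P(1,2) this] have "in_scaled P \<epsilon> (f b *\<^sub>R b)"
    using insert.prems(2)[of b] by simp
  then have "in_scaled P (\<epsilon> + card B * \<epsilon>) (f b *\<^sub>R b + (\<Sum>b\<in>B. f b *\<^sub>R b))"
    using insert \<epsilon> by (intro in_scaled_add[OF P(1)]) auto
  then show ?case using insert.hyps by (simp add: distrib_right)
qed

text \<open>If \<open>X\<close> is 1-separated in the norm of \<open>P\<close>, the sums \<open>\<Sum>i<n. x i / 4 ^ i\<close> over \<open>X\<close> are \<open>4 ^ (- n) / 3\<close>-separated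
  and bounded. Counting the cells of a grid then gives \<open>card X ^ n \<le> C * 4 ^ (d * n)\<close> for all \<open>n\<close>; this
  replaces a comparison of volumes, as there is no Lebesgue measure on the polytope's space.\<close>

fun quarter_sum :: "'a::real_vector list \<Rightarrow> 'a" where
  "quarter_sum [] = 0"
| "quarter_sum (x # xs) = x + (1/4) *\<^sub>R quarter_sum xs"

text \<open>Geometric series: 1 + 1/4 * 4/3 = 4/3.\<close>

lemma quarter_sum_in_scaled:
  assumes P: "convex P" "0 \<in> P" and "set xs \<subseteq> P"
  shows "in_scaled P (4/3) (quarter_sum xs)"
  using assms(3)
proof (induction xs)
  case Nil
  then show ?case using P(2) by (auto simp: in_scaled_def)
next
  case (Cons x xs)
  have "in_scaled P 1 x" using Cons.prems by (auto simp: in_scaled_def)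
  moreover have "in_scaled P (1/4 * (4/3)) ((1/4) *\<^sub>R quarter_sum xs)"
    using Cons by (intro in_scaled_scale) auto
  ultimately have "in_scaled P (1 + 1/4 * (4/3)) (x + (1/4) *\<^sub>R quarter_sum xs)"
    by (intro in_scaled_add[OF P(1)]) auto
  then show ?case by simp
qed

text \<open>At the first difference the letters are 1 apart and the scaled tails differ by at most
  1/4 * 8/3 = 2/3, which leaves 1/3; each common letter before it costs a factor 4.\<close>

lemma quarter_sum_separated:
  assumes P: "convex P" "0 \<in> P" "\<forall>q\<in>P. - q \<in> P" and X: "X \<subseteq> P"
    and sep: "\<And>x y c. x \<in> X \<Longrightarrow> y \<in> X \<Longrightarrow> x \<noteq> y \<Longrightarrow> 0 \<le> c \<Longrightarrow> in_scaled P c (x - y) \<Longrightarrow> 1 \<le> c"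
    and len: "length xs = length ys" and "set xs \<subseteq> X" "set ys \<subseteq> X" "xs \<noteq> ys"
    and "0 \<le> \<eta>" "in_scaled P \<eta> (quarter_sum xs - quarter_sum ys)"
  shows "1 / 3 \<le> 4 ^ length xs * \<eta>"
  using len assms(7-)
proof (induction xs ys arbitrary: \<eta> rule: list_induct2)
  case Nil
  then show ?case by simp
next
  case (Cons x xs y ys)
  let ?D = "quarter_sum xs - quarter_sum ys"
  have eq: "quarter_sum (x # xs) - quarter_sum (y # ys) = (x - y) + (1/4) *\<^sub>R ?D"
    by (simp add: scaleR_diff_right)
  show ?case
  proof (cases "x = y")
    case True
    have "in_scaled P (4 * \<eta>) (4 *\<^sub>R (quarter_sum (x # xs) - quarter_sum (y # ys)))"
      using Cons.prems by (intro in_scaled_scale)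
    then have "in_scaled P (4 * \<eta>) ?D" unfolding eq using True by simp
    then have "1 / 3 \<le> 4 ^ length xs * (4 * \<eta>)"
      using Cons.prems True by (intro Cons.IH) auto
    then show ?thesis by (simp add: mult_ac)
  next
    case False
    have "in_scaled P (4/3) (quarter_sum xs)" "in_scaled P (4/3) (- quarter_sum ys)"
      using Cons.prems X by (auto intro!: quarter_sum_in_scaled P in_scaled_minus)
    then have "in_scaled P (4/3 + 4/3) (quarter_sum xs + - quarter_sum ys)"
      by (intro in_scaled_add[OF P(1)]) auto
    then have "in_scaled P (1/4 * (8/3)) ((1/4) *\<^sub>R ?D)"
      by (intro in_scaled_scale) simp
    then have "in_scaled P (1/4 * (8/3)) (- ((1/4) *\<^sub>R ?D))" by (rule in_scaled_minus[OF P(3)])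
    then have "in_scaled P (\<eta> + 1/4 * (8/3))
        ((quarter_sum (x # xs) - quarter_sum (y # ys)) + - ((1/4) *\<^sub>R ?D))"
      using Cons.prems by (intro in_scaled_add[OF P(1)]) auto
    then have "in_scaled P (\<eta> + 2/3) (x - y)" unfolding eq by simp
    then have "1 \<le> \<eta> + 2/3" using Cons.prems False by (intro sep) auto
    then have "1/3 \<le> \<eta>" by simp
    also have "\<dots> \<le> 4 ^ length (x # xs) * \<eta>"
      using mult_right_mono[OF one_le_power[of "4 :: real" "length (x # xs)"] Cons.prems(4)] by simp
    finally show ?thesis .
  qed
qed

text \<open>Taking \<open>n\<close>-th roots makes \<open>C\<close> disappear in the limit, so
  constants in the cell count are free.\<close>

lemma le_of_power_le:
  fixes a b C :: real
  assumes "0 < b" "\<And>n. a ^ n \<le> C * b ^ n"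
  shows "a \<le> b"
proof (rule ccontr)
  assume "\<not> a \<le> b"
  then have "1 < a / b" using assms(1) by simp
  then obtain n where "C < (a / b) ^ n" using real_arch_pow by blast
  then have "C * b ^ n < a ^ n" using assms(1) by (simp add: power_divide pos_less_divide_eq)
  then show False using assms(2)[of n] by simp
qed

lemma packing_bound:
  fixes P :: "'a::real_vector set"
  assumes P: "convex P" "0 \<in> P" "\<forall>q\<in>P. - q \<in> P"
    and B: "independent B" "finite B" "B \<subseteq> P" "card B \<le> d"
    and X: "finite X" "X \<subseteq> P" "X \<subseteq> span B"
    and sep: "\<And>x y c. x \<in> X \<Longrightarrow> y \<in> X \<Longrightarrow> x \<noteq> y \<Longrightarrow> 0 \<le> c \<Longrightarrow> in_scaled P c (x - y) \<Longrightarrow> 1 \<le> c"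
  shows "card X \<le> 4 ^ d"
proof -
  let ?rep = "representation B"
  obtain D :: nat where D: "\<And>x b. x \<in> X \<Longrightarrow> b \<in> B \<Longrightarrow> \<bar>?rep x b\<bar> \<le> real D"
  proof -
    let ?M = "\<Sum>x\<in>X. \<Sum>b\<in>B. \<bar>?rep x b\<bar>"
    have "\<bar>?rep x b\<bar> \<le> real (nat \<lceil>?M\<rceil>)" if "x \<in> X" "b \<in> B" for x b
    proof -
      have "\<bar>?rep x b\<bar> \<le> (\<Sum>b\<in>B. \<bar>?rep x b\<bar>)" using that B(2) by (intro member_le_sum) auto
      also have "\<dots> \<le> ?M"
        using that X(1) by (intro member_le_sum[of x X "\<lambda>x. \<Sum>b\<in>B. \<bar>?rep x b\<bar>"]) (auto intro: sum_nonneg)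
      finally show ?thesis by linarith
    qed
    then show thesis using that by blast
  qed
  have span_q: "quarter_sum xs \<in> span B" if "set xs \<subseteq> X" for xs
    using that X(3) by (induction xs) (auto intro!: span_add span_mul span_zero)
  have rep_q: "\<bar>?rep (quarter_sum xs) b\<bar> \<le> 2 * real D" if "set xs \<subseteq> X" "b \<in> B" for xs b
    using that(1)
  proof (induction xs)
    case Nil
    then show ?case using representation_zero[of B] by simp
  next
    case (Cons x xs)
    have "?rep (quarter_sum (x # xs)) b = ?rep x b + (1/4) * ?rep (quarter_sum xs) b"
      using Cons.prems X(3) span_q[of xs] B(1)
      by (simp add: representation_add representation_scale span_mul subset_iff)
    moreover have "\<bar>?rep x b\<bar> \<le> real D" using D Cons.prems that(2) by simp
    moreover have "\<bar>?rep (quarter_sum xs) b\<bar> \<le> 2 * real D" using Cons by simp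
    ultimately show ?case by linarith
  qed
  \<comment> \<open>Quarter sums in one cell of mesh \<open>1 / (K * 4 ^ n)\<close> are within
    \<open>d / (K * 4 ^ n)\<close> in the norm of \<open>P\<close>; \<open>K > 3 * d\<close> brings
    this below their separation.\<close>
  define K where "K = 4 * (d + 1)"
  have count: "real (card X) ^ n \<le> real ((5 * (D + 1) * K) ^ d) * (4 ^ d) ^ n" for n
  proof -
    let ?L = "{xs. set xs \<subseteq> X \<and> length xs = n}"
    define M where "M = K * 4 ^ n"
    have M: "0 < M" by (simp add: M_def K_def)
    define cell where "cell xs = restrict (\<lambda>b. \<lfloor>?rep (quarter_sum xs) b * real M\<rfloor>) B" for xs
    have inj: "inj_on cell ?L"
    proof (rule inj_onI, rule ccontr)
      fix xs ys assume xs: "xs \<in> ?L" and ys: "ys \<in> ?L" and eq: "cell xs = cell ys" and neq: "xs \<noteq> ys"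
      let ?f = "\<lambda>b. ?rep (quarter_sum xs) b - ?rep (quarter_sum ys) b"
      have small: "\<bar>?f b\<bar> \<le> 1 / real M" if "b \<in> B" for b
      proof -
        have "\<lfloor>?rep (quarter_sum xs) b * real M\<rfloor> = \<lfloor>?rep (quarter_sum ys) b * real M\<rfloor>"
          using fun_cong[OF eq, of b] that by (simp add: cell_def)
        then have "\<bar>?rep (quarter_sum xs) b * real M - ?rep (quarter_sum ys) b * real M\<bar> \<le> 1" by linarith
        then have "\<bar>?f b\<bar> * real M \<le> 1" by (simp add: abs_mult flip: left_diff_distrib)
        then show ?thesis using M by (simp add: pos_le_divide_eq)
      qed
      have "in_scaled P (card B * (1 / real M)) (\<Sum>b\<in>B. ?f b *\<^sub>R b)"
      proof (rule in_scaled_combination[OF P B(2,3)])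
        fix b assume "b \<in> B"
        then show "\<bar>?f b\<bar> \<le> 1 / real M" by (rule small)
      qed
      moreover have "(\<Sum>b\<in>B. ?rep (quarter_sum zs) b *\<^sub>R b) = quarter_sum zs" if "zs \<in> ?L" for zs
        using sum_representation_eq[OF B(1) span_q B(2)] that by auto
      ultimately have "in_scaled P (card B * (1 / real M)) (quarter_sum xs - quarter_sum ys)"
        using xs ys by (simp add: scaleR_diff_left sum_subtractf)
      then have "1 / 3 \<le> 4 ^ length xs * (card B * (1 / real M))"
        using xs ys neq by (intro quarter_sum_separated[OF P X(2) sep]) auto
      also have "\<dots> = card B / K" using xs by (simp add: M_def)
      also have "\<dots> \<le> d / K" using B(4) by (intro divide_right_mono) auto
      also have "\<dots> < 1 / 3" by (simp add: K_def field_simps)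
      finally show False by simp
    qed
    let ?I = "{- int (2 * D * M) .. int (2 * D * M)}"
    have img: "cell ` ?L \<subseteq> PiE B (\<lambda>_. ?I)"
    proof (rule image_subsetI)
      fix xs assume "xs \<in> ?L"
      then have xs: "set xs \<subseteq> X" by simp
      show "cell xs \<in> PiE B (\<lambda>_. ?I)"
      proof (rule PiE_I)
        fix b assume b: "b \<in> B"
        have "\<bar>?rep (quarter_sum xs) b * real M\<bar> \<le> 2 * real D * real M"
          unfolding abs_mult using rep_q[OF xs b] by (intro mult_mono) auto
        then have "\<bar>?rep (quarter_sum xs) b * real M\<bar> \<le> real_of_int (int (2 * D * M))" by simp
        then have "- int (2 * D * M) \<le> \<lfloor>?rep (quarter_sum xs) b * real M\<rfloor>"
          "\<lfloor>?rep (quarter_sum xs) b * real M\<rfloor> \<le> int (2 * D * M)"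
          unfolding le_floor_iff floor_le_iff by linarith+
        then show "cell xs b \<in> ?I" using b by (simp add: cell_def)
      qed (simp add: cell_def)
    qed
    have "card X ^ n = card ?L" by (rule card_lists_length_eq[OF X(1), symmetric])
    also have "\<dots> \<le> card (PiE B (\<lambda>_. ?I))"
      using inj img by (rule card_inj_on_le) (auto intro: finite_PiE B)
    also have "\<dots> = (4 * D * M + 1) ^ card B" 
    proof -
      have "card ?I = 4 * D * M + 1"
        unfolding card_atLeastAtMost_int by (simp add: nat_eq_iff)
      then show ?thesis using B(2) by (simp only: card_PiE prod_constant)
    qed
    \<comment> \<open>Absorbing the 1 makes the count homogeneous in \<open>M\<close>, so
      \<open>n\<close> enters only through \<open>(4 ^ d) ^ n\<close>.\<close>
    also have "\<dots> \<le> (5 * (D + 1) * M) ^ card B"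
    proof (rule power_mono)
      have "4 * (D * M) + 1 \<le> 5 * (D * M) + 5 * M" using M by linarith
      then show "4 * D * M + 1 \<le> 5 * (D + 1) * M" by (simp add: algebra_simps)
    qed simp
    also have "\<dots> \<le> (5 * (D + 1) * M) ^ d" using M B(4) by (intro power_increasing) auto
    finally have "real (card X ^ n) \<le> real ((5 * (D + 1) * M) ^ d)" by (rule of_nat_mono)
    then show ?thesis by (simp add: M_def power_mult_distrib mult.assoc flip: power_mult) (simp add: mult.commute)
  qed
  have "real (card X) \<le> 4 ^ d" by (rule le_of_power_le[OF _ count]) simp
  then show ?thesis by (metis of_nat_le_iff of_nat_numeral of_nat_power)
qed

section \<open>Neighborliness bounds separated families\<close>

text \<open>Unlike the \<open>pairwise\<close> condition in \<open>neighborly\<close>, this also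
  excludes 0.\<close>

definition antipode_free :: "'a::real_vector set \<Rightarrow> bool" where
  "antipode_free S \<longleftrightarrow> (\<forall>u\<in>S. - u \<notin> S)"

lemma eq_uminus_imp_zero:
  fixes x :: "'a::real_vector"
  assumes "x = - x" shows "x = 0"
proof -
  have "2 *\<^sub>R x = x + x" by (rule scaleR_2)
  also have "\<dots> = x + - x" using assms by simp
  finally show ?thesis by simp
qed

text \<open>Greedy: while \<open>card U < k\<close>, the set \<open>U\<close> and its negatives
  cannot exhaust \<open>V\<close>.\<close>

lemma antipode_free_extend:
  assumes V: "finite V" "\<forall>v\<in>V. - v \<in> V" "0 \<notin> V"
    and U: "U \<subseteq> V" "antipode_free U" "card U \<le> k" "2 * k \<le> card V"
  shows "\<exists>U'. U \<subseteq> U' \<and> U' \<subseteq> V \<and> antipode_free U' \<and> card U' = k"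
  using U
proof (induction "k - card U" arbitrary: U)
  case 0
  then show ?case by (intro exI[of _ U]) auto
next
  case (Suc r)
  have finU: "finite U" using Suc.prems(1) V(1) by (rule finite_subset)
  have "card (U \<union> uminus ` U) \<le> card U + card (uminus ` U)" by (rule card_Un_le)
  also have "\<dots> \<le> card U + card U" using card_image_le[OF finU, of uminus] by simp
  also have "\<dots> < card V" using Suc.hyps(2) Suc.prems by linarith
  finally have "\<not> V \<subseteq> U \<union> uminus ` U" using finU by (metis card_mono finite_UnI finite_imageI not_le)
  then obtain v where v: "v \<in> V" "v \<notin> U" "v \<notin> uminus ` U" by blast
  have "v \<noteq> - v" using v(1) V(3) eq_uminus_imp_zero by metis
  moreover have "- v \<notin> U" using v(3) by (metis image_eqI minus_minus)
  ultimately have "antipode_free (insert v U)"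
    using Suc.prems(2) v(2,3) unfolding antipode_free_def by auto
  moreover have "card (insert v U) = Suc (card U)" using finU v(2) by simp
  moreover have "r = k - Suc (card U)" "Suc (card U) \<le> k" using Suc.hyps(2) by linarith+
  ultimately have "\<exists>U'. insert v U \<subseteq> U' \<and> U' \<subseteq> V \<and> antipode_free U' \<and> card U' = k"
    using Suc.prems v(1) by (intro Suc.hyps(1)) auto
  then show ?case by blast
qed

lemma zero_in_open_segment:
  assumes "v \<noteq> (0 :: 'a::real_vector)" "0 < c" shows "0 \<in> open_segment (c *\<^sub>R v) (- (c *\<^sub>R v))"
proof -
  have "c *\<^sub>R v \<noteq> - (c *\<^sub>R v)" using assms eq_uminus_imp_zero by (metis scaleR_eq_0_iff less_irrefl)
  moreover have "0 = (1 - 1/2) *\<^sub>R (c *\<^sub>R v) + (1/2) *\<^sub>R (- (c *\<^sub>R v))" by simp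
  ultimately show ?thesis unfolding in_segment by (intro conjI exI[of _ "1/2"]) auto
qed

context
  fixes P :: "'a::real_vector set" and k :: nat
  assumes cvx: "convex P" and sym: "\<forall>x\<in>P. - x \<in> P" and nb: "neighborly k P"
begin

lemma card_vertices_pos: "0 < card (vertices P)" "finite (vertices P)"
  using nb unfolding neighborly_def by (auto intro: card_ge_0_finite)

lemma vertices_subset: "vertices P \<subseteq> P"
  unfolding vertices_def extreme_point_of_def by auto

lemma vertices_uminus: "\<forall>v\<in>vertices P. - v \<in> vertices P"
proof
  fix v assume v: "v \<in> vertices P"
  have "- v \<in> P" using v vertices_subset sym by auto
  moreover have "- v \<notin> open_segment a b" if ab: "a \<in> P" "b \<in> P" for a b
  proof
    assume "- v \<in> open_segment a b"
    then obtain u where u: "a \<noteq> b" "0 < u" "u < 1" "- v = (1 - u) *\<^sub>R a + u *\<^sub>R b"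
      unfolding in_segment by blast
    have "v = - (- v)" by simp
    also have "\<dots> = (1 - u) *\<^sub>R (- a) + u *\<^sub>R (- b)" unfolding u(4) by simp
    finally have "v = (1 - u) *\<^sub>R (- a) + u *\<^sub>R (- b)" .
    then have "v \<in> open_segment (- a) (- b)" using u unfolding in_segment by auto
    then show False using v sym ab unfolding vertices_def extreme_point_of_def by blast
  qed
  ultimately show "- v \<in> vertices P" unfolding vertices_def extreme_point_of_def by blast
qed

lemma zero_not_vertex: "0 \<notin> vertices P"
proof
  assume z: "0 \<in> vertices P"
  have "2 \<le> card (vertices P)" using nb unfolding neighborly_def by linarith
  then have "vertices P \<noteq> {0}" using card_1_singleton_iff[of "vertices P"] by force
  then obtain v where v: "v \<in> vertices P" "v \<noteq> 0" using z by blast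
  then have "0 \<in> open_segment v (- v)" using zero_in_open_segment[of v 1] by simp
  moreover have "v \<in> P" "- v \<in> P" using v(1) vertices_subset sym by auto
  ultimately show False using z unfolding vertices_def extreme_point_of_def by blast
qed

lemma zero_in_body: "0 \<in> P"
proof -
  obtain v where "v \<in> vertices P" using card_vertices_pos(1) by fastforce
  then have "v \<in> P" "- v \<in> P" using vertices_subset sym by auto
  then have "(1/2) *\<^sub>R v + (1/2) *\<^sub>R (- v) \<in> P" by (intro convexD[OF cvx]) auto
  then show ?thesis by simp
qed

text \<open>\<open>neighborly\<close> speaks of sets of size exactly \<open>k\<close>, so
  \<open>U\<close> is extended first. A face through 0 would contain \<open>x\<close> and
  \<open>- x\<close> for every \<open>x\<close> in \<open>P\<close>, hence be \<open>P\<close>,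
  whose vertices are not antipode-free.\<close>

lemma proper_face_exists:
  assumes U: "U \<subseteq> vertices P" "antipode_free U" "card U \<le> k"
  obtains F where "F face_of P" "U \<subseteq> F" "0 \<notin> F"
proof -
  have "2 * k \<le> card (vertices P)" using nb unfolding neighborly_def by simp
  then obtain U' where U': "U \<subseteq> U'" "U' \<subseteq> vertices P" "antipode_free U'" "card U' = k"
    using antipode_free_extend[OF card_vertices_pos(2) vertices_uminus zero_not_vertex U] by blast
  have "pairwise (\<lambda>u v. u \<noteq> - v) U'"
    using U'(3) unfolding antipode_free_def pairwise_def by force
  then obtain F where F: "F face_of P" "vertices F = U'"
    using nb U' unfolding neighborly_def by blast
  have "U' \<subseteq> F" using F(2) unfolding vertices_def extreme_point_of_def by auto
  moreover have "0 \<notin> F"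
  proof
    assume z: "0 \<in> F"
    have "x \<in> F" if x: "x \<in> P" for x
    proof (cases "x = 0")
      case False
      then have "0 \<in> open_segment x (- x)" using zero_in_open_segment[of x 1] by simp
      then show ?thesis using face_ofD[OF F(1) _ x] sym x z by blast
    qed (use z in simp)
    then have "F = P" using F(1) face_of_imp_subset by blast
    then have "U' = vertices P" using F(2) by simp
    moreover obtain v where "v \<in> vertices P" using card_vertices_pos(1) by fastforce
    ultimately show False using U'(3) vertices_uminus unfolding antipode_free_def by blast
  qed
  ultimately show thesis using that F(1) U'(1) by blast
qed

text \<open>If \<open>c = t *\<^sub>R q\<close> with \<open>t < 1\<close>, then \<open>c\<close> is
  inside the segment from \<open>q\<close> to \<open>- q\<close>; the face contains both ends and so
  0.\<close>

lemma face_not_interior: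
  assumes F: "F face_of P" "0 \<notin> F" and c: "c \<in> F" "in_scaled P t c" "0 \<le> t"
  shows "1 \<le> t"
proof (rule ccontr)
  assume t1: "\<not> 1 \<le> t"
  obtain q where q: "q \<in> P" "c = t *\<^sub>R q" using c(2) unfolding in_scaled_def by blast
  have q0: "q \<noteq> 0" and "t \<noteq> 0" using c(1) F(2) q(2) by auto
  have ne: "q \<noteq> - q" using q0 eq_uminus_imp_zero by metis
  have "c = (1 - (1 - t) / 2) *\<^sub>R q + ((1 - t) / 2) *\<^sub>R (- q)"
    unfolding q(2) by (simp add: scaleR_diff_left[symmetric])
  then have "c \<in> open_segment q (- q)"
    unfolding in_segment using ne t1 c(3) by (intro conjI exI[of _ "(1 - t) / 2"]) auto
  then have "q \<in> F" "- q \<in> F" using face_ofD[OF F(1) _ q(1)] sym q(1) c(1) by blast+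
  then have "(1/2) *\<^sub>R q + (1/2) *\<^sub>R (- q) \<in> F"
    using face_of_imp_convex[OF F(1)] by (intro convexD) auto
  then show False using F(2) by simp
qed

lemma average_in_face:
  assumes "F face_of P" "finite U" "U \<noteq> {}" "U \<subseteq> F"
  shows "(1 / real (card U)) *\<^sub>R (\<Sum>u\<in>U. u) \<in> F"
proof -
  have "(\<Sum>u\<in>U. (1 / real (card U)) *\<^sub>R u) \<in> F"
    using assms face_of_imp_convex[OF assms(1)] by (intro convex_sum) auto
  then show ?thesis by (simp add: scaleR_sum_right)
qed

text \<open>Negating the vertices with negative coefficients turns a linear relation into a convex
  combination equal to 0, in a face that avoids 0. The upper bound gets \<open>k \<le> d\<close>
  from this.\<close>

lemma antipode_free_independent:
  assumes U: "U \<subseteq> vertices P" "antipode_free U" "card U \<le> k"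
  shows "independent U"
proof (rule independent_if_scalars_zero)
  show finU: "finite U" using U(1) card_vertices_pos(2) by (rule finite_subset)
  fix f :: "'a \<Rightarrow> real" and w
  assume s: "(\<Sum>u\<in>U. f u *\<^sub>R u) = 0" and w: "w \<in> U"
  show "f w = 0"
  proof (rule ccontr)
    assume fw: "f w \<noteq> 0"
    define g where "g u = (if f u < 0 then - u else u)" for u
    have "g ` U \<subseteq> vertices P" using U(1) vertices_uminus by (auto simp: g_def)
    moreover have "antipode_free (g ` U)"
      unfolding antipode_free_def
    proof (intro ballI notI)
      fix v assume "v \<in> g ` U" "- v \<in> g ` U"
      then obtain a b where ab: "a \<in> U" "b \<in> U" "v = g a" "- v = g b" by auto
      then have "a = b \<or> a = - b" by (auto simp: g_def split: if_splits)
      then have "a = b" using ab U(2) unfolding antipode_free_def by auto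
      then have "- v = v" using ab by simp
      then have "v = 0" using eq_uminus_imp_zero by metis
      then have "a = 0" using ab by (auto simp: g_def split: if_splits)
      then show False using zero_not_vertex U(1) ab(1) by blast
    qed
    moreover have "card (g ` U) \<le> k" using card_image_le[OF finU, of g] U(3) by linarith
    ultimately obtain F where F: "F face_of P" "g ` U \<subseteq> F" "0 \<notin> F"
      by (rule proper_face_exists)
    define t where "t = (\<Sum>u\<in>U. \<bar>f u\<bar>)"
    have t: "0 < t" unfolding t_def using w fw finU by (intro sum_pos2) auto
    have "(\<Sum>u\<in>U. (\<bar>f u\<bar> / t) *\<^sub>R g u) \<in> F"
    proof (rule convex_sum[OF finU face_of_imp_convex[OF F(1)]])
      show "(\<Sum>u\<in>U. \<bar>f u\<bar> / t) = 1" using t by (simp add: t_def flip: sum_divide_distrib)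
    qed (use F(2) t in auto)
    also have "(\<Sum>u\<in>U. (\<bar>f u\<bar> / t) *\<^sub>R g u) = (\<Sum>u\<in>U. (1 / t) *\<^sub>R (f u *\<^sub>R u))"
      by (intro sum.cong) (auto simp: g_def)
    also have "\<dots> = 0" using s by (simp only: scaleR_sum_right[symmetric] scaleR_zero_right)
    finally show False using F(3) by simp
  qed
qed

text \<open>After cancelling \<open>S \<inter> T\<close>, the difference is
  \<open>card U / s\<close> times the barycentre of \<open>U\<close>, the set \<open>S - T\<close>
  with the negatives of \<open>T - S\<close>. A proper face contains \<open>U\<close>, so the
  barycentre has norm at least 1, and \<open>s \<le> card U\<close>.\<close>

lemma average_differences_separated:
  assumes W: "W \<subseteq> vertices P" "antipode_free W"
    and S: "S \<subseteq> W" "card S = s" and T: "T \<subseteq> W" "card T = s" and "S \<noteq> T" "2 * s \<le> k" "2 * card (S \<inter> T) \<le> s"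
  defines "x \<equiv> \<lambda>S. (1 / real s) *\<^sub>R (\<Sum>v\<in>S. v)"
  shows "x S \<noteq> x T" "0 \<le> t \<Longrightarrow> in_scaled P t (x S - x T) \<Longrightarrow> 1 \<le> t"
proof -
  have finW: "finite W" using W(1) card_vertices_pos(2) by (rule finite_subset)
  then have fin: "finite S" "finite T" using S(1) T(1) finite_subset by blast+
  define U where "U = (S - T) \<union> uminus ` (T - S)"
  have disj: "(S - T) \<inter> uminus ` (T - S) = {}"
    using S(1) T(1) W(2) unfolding antipode_free_def by auto
  have inj: "inj_on uminus (T - S)" by (simp add: inj_on_def)
  have "card (S - T) = s - card (S \<inter> T)" "card (T - S) = s - card (S \<inter> T)"
    using S(2) T(2) fin by (simp_all add: card_Diff_subset_Int Int_commute)
  moreover have "card (S \<inter> T) \<le> s" using card_mono[OF fin(1), of "S \<inter> T"] S(2) by auto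
  ultimately have cU: "card U = 2 * (s - card (S \<inter> T))"
    using fin by (simp add: U_def card_Un_disjoint disj card_image[OF inj])
  have "s \<noteq> 0" using S T fin \<open>S \<noteq> T\<close> by auto
  then have s: "0 < s" "s \<le> card U" "card U \<le> k" using cU assms(8,9) by auto
  have "U \<subseteq> vertices P" using S(1) T(1) W(1) vertices_uminus by (auto simp: U_def)
  moreover have "antipode_free U"
    using S(1) T(1) W(2) unfolding antipode_free_def U_def by auto blast+
  ultimately obtain F where F: "F face_of P" "U \<subseteq> F" "0 \<notin> F"
    using s(3) by (rule proper_face_exists)
  define c where "c = (1 / real (card U)) *\<^sub>R (\<Sum>u\<in>U. u)"
  have cF: "c \<in> F"
    unfolding c_def using F(1,2) s fin by (intro average_in_face) (auto simp: U_def)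
  have "(\<Sum>u\<in>U. u) = (\<Sum>v\<in>S - T. v) - (\<Sum>v\<in>T - S. v)"
    unfolding U_def using fin disj by (simp add: sum.union_disjoint sum.reindex[OF inj] sum_negf)
  also have "\<dots> = (\<Sum>v\<in>S. v) - (\<Sum>v\<in>T. v)"
    using sum.Int_Diff[OF fin(1), of "\<lambda>v. v" T] sum.Int_Diff[OF fin(2), of "\<lambda>v. v" S]
    by (simp add: Int_commute)
  finally have "x S - x T = (1 / real s) *\<^sub>R (\<Sum>u\<in>U. u)"
    by (simp add: x_def scaleR_diff_right)
  then have cx: "c = (real s / real (card U)) *\<^sub>R (x S - x T)" using s by (simp add: c_def)
  then show "x S \<noteq> x T" using cF F(3) by auto
  assume t: "0 \<le> t" "in_scaled P t (x S - x T)"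
  have "in_scaled P (real s / real (card U) * t) c"
    unfolding cx using t(2) by (rule in_scaled_scale)
  then have "1 \<le> real s / real (card U) * t"
    using t(1) by (intro face_not_interior[OF F(1,3) cF]) auto
  also have "\<dots> \<le> 1 * t" using s t(1) by (intro mult_right_mono) auto
  finally show "1 \<le> t" by simp
qed

end

section \<open>Set families with small intersections, and the upper bound\<close>

lemma card_large_intersection:
  assumes W: "finite W" "card W = m" and S: "S \<subseteq> W" "card S = s"
  shows "card {T. T \<subseteq> W \<and> card T = s \<and> j \<le> card (S \<inter> T)} \<le> (s choose j) * ((m - j) choose (s - j))"
proof -
  have finS: "finite S" using S(1) W(1) by (rule finite_subset)
  let ?R = "{R. R \<subseteq> S \<and> card R = j}"
  let ?Q = "\<lambda>R. {Q. Q \<subseteq> W - R \<and> card Q = s - j}"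
  have finR: "finite ?R" using finS by simp
  have finQ: "finite (?Q R)" for R using W(1) by simp
  \<comment> \<open>\<open>T\<close> splits into \<open>j\<close> elements of \<open>S\<close> and a
    remainder; several splittings of one \<open>T\<close> only overcount.\<close>
  have "{T. T \<subseteq> W \<and> card T = s \<and> j \<le> card (S \<inter> T)} \<subseteq> (\<lambda>(R, Q). R \<union> Q) ` (SIGMA R:?R. ?Q R)"
  proof (intro subsetI, elim CollectE conjE)
    fix T assume T: "T \<subseteq> W" "card T = s" "j \<le> card (S \<inter> T)"
    then obtain R where R: "R \<subseteq> S \<inter> T" "card R = j" "finite R"
      by (meson obtain_subset_with_card_n)
    then have "card (T - R) = s - j" using T(2) by (subst card_Diff_subset) auto
    then have "(R, T - R) \<in> (SIGMA R:?R. ?Q R)" using R T(1) by auto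
    moreover have "T = R \<union> (T - R)" using R(1) by auto
    ultimately show "T \<in> (\<lambda>(R, Q). R \<union> Q) ` (SIGMA R:?R. ?Q R)" by (metis (no_types, lifting) case_prod_conv image_eqI)
  qed
  then have "card {T. T \<subseteq> W \<and> card T = s \<and> j \<le> card (S \<inter> T)} \<le> card (SIGMA R:?R. ?Q R)"
    using finR finQ by (meson card_image_le card_mono finite_SigmaI finite_imageI le_trans)
  also have "\<dots> = (\<Sum>R\<in>?R. card (?Q R))" using finR finQ by (intro card_SigmaI) auto
  also have "\<dots> = (\<Sum>R\<in>?R. (m - j) choose (s - j))"
  proof (rule sum.cong[OF refl])
    fix R assume R: "R \<in> ?R"
    then have "R \<subseteq> W" "finite R" using S(1) finS finite_subset by auto
    then have "card (W - R) = m - j" using R W(2) by (simp add: card_Diff_subset)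
    then show "card (?Q R) = (m - j) choose (s - j)" using W(1) by (simp add: n_subsets)
  qed
  also have "\<dots> = (s choose j) * ((m - j) choose (s - j))" using finS S(2) by (simp add: n_subsets)
  finally show ?thesis .
qed

text \<open>A maximal family with small pairwise intersections covers all \<open>s\<close>-subsets (Gilbert--Varshamov).\<close>

lemma large_code_exists:
  assumes W: "finite W" "card W = m"
  obtains C where "finite C" "\<And>S. S \<in> C \<Longrightarrow> S \<subseteq> W \<and> card S = s"
    "\<And>S T. S \<in> C \<Longrightarrow> T \<in> C \<Longrightarrow> S \<noteq> T \<Longrightarrow> 2 * card (S \<inter> T) \<le> s"
    "m choose s \<le> card C * ((s choose ((s + 1) div 2)) * ((m - (s + 1) div 2) choose (s - (s + 1) div 2)))"
proof -
  \<comment> \<open>Half of \<open>s\<close> rounded up: a forbidden intersection has at least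
    \<open>?j\<close> elements, and \<open>s \<le> 2 * ?j\<close> is what the final estimate
    uses.\<close>
  let ?j = "(s + 1) div 2"
  define code where "code C \<longleftrightarrow>
    (\<forall>S\<in>C. S \<subseteq> W \<and> card S = s) \<and> (\<forall>S\<in>C. \<forall>T\<in>C. S \<noteq> T \<longrightarrow> 2 * card (S \<inter> T) \<le> s)" for C
  have "{C. code C} \<subseteq> Pow (Pow W)" by (auto simp: code_def)
  then have "finite {C. code C}" using W(1) by (meson finite_Pow_iff finite_subset)
  moreover have "{C. code C} \<noteq> {}" by (auto simp: code_def)
  ultimately have "\<exists>C\<in>{C. code C}. \<forall>C'\<in>{C. code C}. C \<subseteq> C' \<longrightarrow> C = C'"
    by (rule finite_has_maximal)
  then obtain C where "code C" and max: "\<And>C'. code C' \<Longrightarrow> C \<subseteq> C' \<Longrightarrow> C = C'" by blast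
  then have C: "\<forall>S\<in>C. S \<subseteq> W \<and> card S = s" "\<forall>S\<in>C. \<forall>T\<in>C. S \<noteq> T \<longrightarrow> 2 * card (S \<inter> T) \<le> s"
    by (auto simp: code_def)
  have "C \<subseteq> Pow W" using C(1) by auto
  then have finC: "finite C" using W(1) by (meson finite_Pow_iff finite_subset)
  let ?N = "\<lambda>S. {T. T \<subseteq> W \<and> card T = s \<and> ?j \<le> card (S \<inter> T)}"
  have "{T. T \<subseteq> W \<and> card T = s} \<subseteq> (\<Union>S\<in>C. ?N S)"
  proof (intro subsetI, elim CollectE conjE)
    fix T assume T: "T \<subseteq> W" "card T = s"
    show "T \<in> (\<Union>S\<in>C. ?N S)"
    proof (cases "T \<in> C")
      case True
      have "?j \<le> s" by presburger
      then have "T \<in> ?N T" using T by simp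
      with True show ?thesis by blast
    next
      case False
      then have "\<not> code (insert T C)" using max[of "insert T C"] by auto
      then obtain S where "S \<in> C" "\<not> 2 * card (S \<inter> T) \<le> s"
        using C T by (auto simp: code_def Int_commute)
      moreover from this have "?j \<le> card (S \<inter> T)" by linarith
      ultimately show ?thesis using T by auto
    qed
  qed
  then have "card {T. T \<subseteq> W \<and> card T = s} \<le> card (\<Union>S\<in>C. ?N S)"
    using finC W(1) by (intro card_mono finite_UN_I) auto
  then have "m choose s \<le> card (\<Union>S\<in>C. ?N S)" using W by (simp add: n_subsets)
  also have "\<dots> \<le> (\<Sum>S\<in>C. card (?N S))" using finC by (rule card_UN_le)
  also have "\<dots> \<le> (\<Sum>S\<in>C. (s choose ?j) * ((m - ?j) choose (s - ?j)))"
    using C by (intro sum_mono card_large_intersection[OF W]) auto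
  finally have "m choose s \<le> card C * ((s choose ?j) * ((m - ?j) choose (s - ?j)))" by simp
  with finC C show thesis by (intro that[of C]) auto
qed

text \<open>Factor by factor, \<open>(m - i) / (s - i)\<close> is at least
  \<open>m / s\<close>.\<close>

lemma binomial_ratio:
  assumes "j \<le> s" "s \<le> m" "0 < s"
  shows "(real m / real s) ^ j * real (s choose j) \<le> real (m choose j)"
proof -
  have "(real m / real s) ^ j * real (s choose j) = (\<Prod>i<j. real m / real s * (real (s - i) / real (j - i)))"
    by (simp only: binomial_altdef_of_nat[OF assms(1)] prod.distrib prod_constant card_lessThan atLeast0LessThan)
  also have "\<dots> \<le> (\<Prod>i<j. real (m - i) / real (j - i))"
  proof (rule prod_mono)
    fix i assume "i \<in> {..<j}"
    then have i: "i < j" by simp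
    have "real m * real (s - i) \<le> real (m - i) * real s"
      using i assms mult_right_mono[of "real s" "real m" "real i"] by (simp add: of_nat_diff algebra_simps)
    then have "real m / real s * real (s - i) \<le> real (m - i)" using assms by (simp add: field_simps)
    then have "real m / real s * real (s - i) / real (j - i) \<le> real (m - i) / real (j - i)"
      by (intro divide_right_mono) auto
    then show "0 \<le> real m / real s * (real (s - i) / real (j - i)) \<and>
        real m / real s * (real (s - i) / real (j - i)) \<le> real (m - i) / real (j - i)" by simp
  qed
  also have "\<dots> = real (m choose j)" using assms by (simp add: binomial_altdef_of_nat atLeast0LessThan)
  finally show ?thesis .
qed

text \<open>Counting nested pairs of a \<open>j\<close>-set and an \<open>s\<close>-set in two ways
  cancels the second binomial and leaves \<open>m choose j \<le> N * (s choose j)\<^sup>2\<close>.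
  One factor goes into \<open>binomial_ratio\<close>, the other is at most
  \<open>2 ^ s\<close>.\<close>

lemma code_size_bound:
  assumes c: "m choose s \<le> N * ((s choose j) * ((m - j) choose (s - j)))" and "j \<le> s" "s \<le> m" "0 < s"
  shows "(real m / real s) ^ j \<le> real N * 2 ^ s"
proof -
  have pos: "0 < (m - j) choose (s - j)" "0 < s choose j" using assms by auto
  have "(m choose j) * ((m - j) choose (s - j)) = (m choose s) * (s choose j)"
    using choose_mult[OF assms(2,3)] by simp
  also have "\<dots> \<le> N * ((s choose j) * ((m - j) choose (s - j))) * (s choose j)"
    using c by (rule mult_right_mono) simp
  finally have "(m choose j) * ((m - j) choose (s - j)) \<le> (N * (s choose j) * (s choose j)) * ((m - j) choose (s - j))"
    by (simp add: mult_ac)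
  then have "m choose j \<le> N * (s choose j) * (s choose j)" using pos(1) by simp
  then have "real (m choose j) \<le> real (N * (s choose j)) * real (s choose j)"
    by (metis of_nat_le_iff of_nat_mult)
  then have "(real m / real s) ^ j * real (s choose j) \<le> real (N * (s choose j)) * real (s choose j)"
    using binomial_ratio[OF assms(2-4)] by linarith
  then have "(real m / real s) ^ j \<le> real (N * (s choose j))" using pos(2) by simp
  also have "\<dots> \<le> real (N * 2 ^ s)"
    by (intro of_nat_mono mult_left_mono binomial_le_pow2) auto
  finally show ?thesis by simp
qed

text \<open>The code has at least \<open>(m / s) ^ ?j / 2 ^ s\<close> members, while packing allows
  \<open>4 ^ d\<close>. Logarithms give \<open>s * x \<le> 6 * d\<close>, and
  \<open>k \<le> 2 * s + 1\<close> turns this into the constants 1 and 12.\<close>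

lemma neighborly_upper:
  assumes P: "cs_polytope d P" "card (vertices P) = 2 * m" "neighborly k P" and d: "0 < d" "d \<le> m"
  shows "real k \<le> 1 + 12 * real d / (1 + ln (real m / real d))"
proof -
  have cvx: "convex P" using P(1) unfolding cs_polytope_def by (auto intro: polytope_imp_convex)
  have sym: "\<forall>x\<in>P. - x \<in> P" and PE: "P \<subseteq> euclid d" using P(1) unfolding cs_polytope_def by auto
  note body = cvx sym P(3)
  let ?V = "vertices P"
  have VE: "?V \<subseteq> euclid d" using vertices_subset[OF body] PE by blast
  have fin_le: "finite B \<and> card B \<le> d" if "independent B" "B \<subseteq> euclid d" for B
    using independent_span_bound[OF _ that(1), of "unit_vec ` {..<d}"] that(2)
    by (simp add: span_unit_vecs card_image[OF inj_unit_vec])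
  have free: "\<exists>U. U \<subseteq> ?V \<and> antipode_free U \<and> card U = l" if "l \<le> m" for l
    using antipode_free_extend[OF card_vertices_pos(2)[OF body] vertices_uminus[OF body] zero_not_vertex[OF body],
      of "{}" l] that P(2) by (auto simp: antipode_free_def)
  have km: "k \<le> m" using P(2,3) unfolding neighborly_def by simp
  have kd: "k \<le> d"
  proof -
    obtain U where U: "U \<subseteq> ?V" "antipode_free U" "card U = k" using free[OF km] by blast
    have "independent U" using U by (intro antipode_free_independent[OF body]) auto
    then show ?thesis using fin_le[of U] U VE by auto
  qed
  define x where "x = 1 + ln (real m / real d)"
  have x: "1 \<le> x" using d by (simp add: x_def)
  define s where "s = k div 2"
  have ks: "k \<le> 2 * s + 1" "2 * s \<le> k" by (auto simp: s_def)
  have "real s * x \<le> 6 * real d"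
  proof (cases "s = 0")
    case False
    then have s: "0 < s" "s \<le> m" "s \<le> d" using ks km kd by auto
    obtain W where W: "W \<subseteq> ?V" "antipode_free W" "card W = m" using free[of m] by blast
    have finW: "finite W" using W(1) card_vertices_pos(2)[OF body] by (rule finite_subset)
    let ?j = "(s + 1) div 2"
    obtain C where C: "finite C" "\<And>S. S \<in> C \<Longrightarrow> S \<subseteq> W \<and> card S = s"
      "\<And>S T. S \<in> C \<Longrightarrow> T \<in> C \<Longrightarrow> S \<noteq> T \<Longrightarrow> 2 * card (S \<inter> T) \<le> s"
      "m choose s \<le> card C * ((s choose ?j) * ((m - ?j) choose (s - ?j)))"
      using large_code_exists[OF finW W(3)] by blast
    define f where "f S = (1 / real s) *\<^sub>R (\<Sum>v\<in>S. v)" for S :: "rvec set"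
    have sep: "f S \<noteq> f T" "0 \<le> t \<Longrightarrow> in_scaled P t (f S - f T) \<Longrightarrow> 1 \<le> t"
      if "S \<in> C" "T \<in> C" "S \<noteq> T" for S T t
    proof -
      have S: "S \<subseteq> W" "card S = s" and T: "T \<subseteq> W" "card T = s" using C(2) that by auto
      note separated = average_differences_separated[OF body W(1,2) S T that(3) ks(2) C(3)[OF that]]
      show "f S \<noteq> f T" "0 \<le> t \<Longrightarrow> in_scaled P t (f S - f T) \<Longrightarrow> 1 \<le> t"
        unfolding f_def by (fact separated)+
    qed
    have inj: "inj_on f C" using sep(1) by (meson inj_onI)
    obtain B where B: "B \<subseteq> W" "independent B" "W \<subseteq> span B"
      using maximal_independent_subset by blast
    have BE: "B \<subseteq> euclid d" and BP: "B \<subseteq> P" using B(1) W(1) VE vertices_subset[OF body] by auto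
    have "card (f ` C) \<le> 4 ^ d"
    proof (rule packing_bound[OF cvx zero_in_body[OF body] sym B(2)])
      show "finite B" "card B \<le> d" using fin_le[OF B(2) BE] by auto
      show "B \<subseteq> P" by (rule BP)
      show "finite (f ` C)" using C(1) by simp
      show "f ` C \<subseteq> P"
      proof (rule image_subsetI)
        fix S assume "S \<in> C"
        then have S: "S \<subseteq> W" "card S = s" using C(2) by auto
        then have "(\<Sum>v\<in>S. (1 / real s) *\<^sub>R v) \<in> P"
          using finite_subset[OF S(1) finW] W(1) vertices_subset[OF body] s cvx by (intro convex_sum) auto
        then show "f S \<in> P" by (simp add: f_def scaleR_sum_right)
      qed
      show "f ` C \<subseteq> span B"
      proof (rule image_subsetI)
        fix S assume "S \<in> C"
        then have "S \<subseteq> span B" using C(2) B(3) by blast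
        then show "f S \<in> span B" unfolding f_def by (intro span_mul span_sum) blast
      qed
      fix y z c
      assume "y \<in> f ` C" "z \<in> f ` C" "y \<noteq> z" "0 \<le> c" "in_scaled P c (y - z)"
      then show "1 \<le> c" using sep(2) by blast
    qed
    then have "card C \<le> 4 ^ d" by (simp add: card_image[OF inj])
    then have N: "real (card C) \<le> 4 ^ d" by (metis of_nat_le_iff of_nat_numeral of_nat_power)
    have q: "1 \<le> real m / real s" using s by simp
    have "(real m / real s) ^ ?j \<le> real (card C) * 2 ^ s"
      using s by (intro code_size_bound[OF C(4)]) auto
    also have "\<dots> \<le> 4 ^ d * 2 ^ s" using N by (intro mult_right_mono) auto
    finally have "ln ((real m / real s) ^ ?j) \<le> ln (4 ^ d * 2 ^ s)"
      using q s by (subst ln_le_cancel_iff) auto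
    also have "\<dots> = real d * ln 4 + real s * ln 2" by (simp add: ln_mult ln_realpow)
    also have "ln (4::real) = 2 * ln 2"
      using ln_realpow[of 2 2] by simp
    finally have "real ?j * ln (real m / real s) \<le> (2 * real d + real s) * ln 2"
      using q s by (simp add: ln_realpow algebra_simps)
    also have "\<dots> \<le> (2 * real d + real s) * 1"
      using ln_2_less_1 by (intro mult_left_mono) auto
    finally have "2 * (real ?j * ln (real m / real s)) \<le> 4 * real d + 2 * real s" by simp
    moreover have "real s * ln (real m / real s) \<le> 2 * real ?j * ln (real m / real s)"
      using q by (intro mult_right_mono) auto
    moreover have "ln (real m / real d) \<le> ln (real m / real s)"
      using s d by (subst ln_le_cancel_iff) (auto simp: divide_left_mono)
    then have "real s * ln (real m / real d) \<le> real s * ln (real m / real s)"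
      by (intro mult_left_mono) auto
    \<comment> \<open>The other facts add up to \<open>s * x \<le> 4 * d + 3 * s\<close>; this one
      absorbs \<open>3 * s\<close> into \<open>2 * d\<close>.\<close>
    moreover have "real s * 2 \<le> real d" using ks(2) kd by linarith
    moreover have "real s * x = real s + real s * ln (real m / real d)" by (simp add: x_def distrib_left)
    ultimately show ?thesis using s by linarith
  qed (use d in simp)
  then have "real s \<le> 6 * real d / x" using x by (simp add: pos_le_divide_eq)
  moreover have "real k \<le> 2 * real s + 1" using ks(1) by linarith
  ultimately show ?thesis unfolding x_def[symmetric] by simp
qed

theorem theorem1p1:
  shows "(\<exists>C1 C2 :: real. C1 > 0 \<and> C2 > 0 \<and>
            (\<forall>d n :: nat. d \<ge> 2 \<longrightarrow> n \<ge> 1 \<longrightarrow>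
               (let m = n + d in
                  C1 * real d / (1 + ln (real m / real d)) \<le> real (max_neighborly d n) \<and>
                  real (max_neighborly d n) \<le> 1 + C2 * real d / (1 + ln (real m / real d)))))
       \<and> (\<forall>d :: nat. d \<ge> 2 \<longrightarrow>
            (\<exists>P. cs_polytope d P \<and> card (vertices P) = 4 * d \<and>
                 at_least_neighborly (real d / 400) P))"
proof (rule conjI, rule exI[of _ "1 / 1800"], rule exI[of _ 12], intro conjI allI impI)
  fix d n :: nat
  assume d: "2 \<le> d"
  obtain P where "cs_polytope d P" "card (vertices P) = 2 * (n + d)" "neighborly (max_neighborly d n) P"
    using max_neighborly_attained[OF d] by blast
  then have "real (max_neighborly d n) \<le> 1 + 12 * real d / (1 + ln (real (n + d) / real d))"
    using d by (intro neighborly_upper) auto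
  then show "let m = n + d in 1 / 1800 * real d / (1 + ln (real m / real d)) \<le> real (max_neighborly d n) \<and>
      real (max_neighborly d n) \<le> 1 + 12 * real d / (1 + ln (real m / real d))"
    using max_neighborly_lower[OF d, of n] by (simp add: Let_def)
qed (use highly_neighborly_4d in auto)

end
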